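(* Let $C$ be a closed convex cone in $\mathbb{R}^d$. Define the transition width $\omega(C):=\sqrt{\min\{\delta(C),\delta(C^\circ)\}}$ and the function $$p_C(\lambda):=4\exp\left(\frac{-\lambda^2/8}{\omega^2(C)+\lambda}\right)\quad\text{for }\lambda\ge 0.$$ Then, for every $\lambda\ge 0$ and all integers $k_-,k_+\in\{0,1,\dots,d\}$, $$k_-\le\delta(C)-\lambda+1\quad\Longrightarrow\quad t_{k_-}(C)\ge 1-p_C(\lambda);$$ $$k_+\ge\delta(C)+\lambda\quad\Longrightarrow\quad t_{k_+}(C)\le p_C(\lambda).$$ Here $t_k(C):=\sum_{j=k}^d v_j(C)$ is the $k$th tail functional.
   Context: The exponent in $p_C$ is read as $0$ when $\lambda=0$, i.e. $p_C(0)=4$. A convex cone in $\mathbb{R}^d$ is a (nonempty) convex set $C$ with $C=\tau C$ for all $\tau>0$. For a closed convex cone $C$, $\Pi_C(x)$ denotes the point of $C$ nearest to $x$ in Euclidean norm. The polar cone is $C^\circ=\{u\in\mathbb{R}^d:\langle u,x\rangle\le 0\text{ for all }x\in C\}$. Let $g$ be a standard normal vector in $\mathbb{R}^d$. Conic intrinsic volumes: a cone is polyhedral if it is an intersection of finitely many closed halfspaces with the origin on their boundary. For a polyhedral cone $C\subset\mathbb{R}^d$ and $k=0,\dots,d$, $v_k(C) := \mathbb{P}\{\Pi_C(g)$ lies in the relative interior of a $k$-dimensional face of $C\}$. For a general closed convex cone $C$, $v_k(C):=\lim_{i\to\infty} v_k(C_i)$, where $(C_i)$ is any sequence of polyhedral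 cones converging to $C$ in the conic Hausdorff metric (identify each closed convex cone with its intersection with the unit sphere $\mathsf{S}^{d-1}$ and use the Hausdorff metric on the sphere); the limit does not depend on the sequence. Statistical dimension: $\delta(C):=\sum_{k=0}^d k\,v_k(C)$ for a closed convex cone $C\subset\mathbb{R}^d$. *)

theory Defs
  imports "HOL-Probability.Probability"
begin

text \<open>
  The space \<open>\<real>\<^sup>d\<close> is an arbitrary Euclidean space \<^typ>\<open>'a\<close>
  with \<open>d = DIM('a)\<close>. The library predicate \<^const>\<open>convex_cone\<close> requires invariance
  under scaling by all \<open>c \<ge> 0\<close>; for closed sets this is the same as \<open>C = \<tau> C\<close> for
  all \<open>\<tau> > 0\<close>:
\<close>

lemma closed_convex_cone_iff:
  fixes C :: "'a::euclidean_space set"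
  assumes "closed C"
  shows "convex_cone C \<longleftrightarrow> C \<noteq> {} \<and> convex C \<and> (\<forall>\<tau>>0. C = (\<lambda>x. \<tau> *\<^sub>R x) ` C)"
proof
  assume C: "convex_cone C"
  have "C = (\<lambda>x. \<tau> *\<^sub>R x) ` C" if "\<tau> > 0" for \<tau> :: real
  proof
    show "(\<lambda>x. \<tau> *\<^sub>R x) ` C \<subseteq> C"
      using C that by (auto intro: convex_cone_scaleR)
    show "C \<subseteq> (\<lambda>x. \<tau> *\<^sub>R x) ` C"
    proof
      fix x assume "x \<in> C"
      then have "inverse \<tau> *\<^sub>R x \<in> C"
        using C that by (auto intro: convex_cone_scaleR)
      moreover have "x = \<tau> *\<^sub>R (inverse \<tau> *\<^sub>R x)"
        using that by simp
      ultimately show "x \<in> (\<lambda>x. \<tau> *\<^sub>R x) ` C"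
        by blast
    qed
  qed
  then show "C \<noteq> {} \<and> convex C \<and> (\<forall>\<tau>>0. C = (\<lambda>x. \<tau> *\<^sub>R x) ` C)"
    using C by (auto simp: convex_cone_def)
next
  assume C: "C \<noteq> {} \<and> convex C \<and> (\<forall>\<tau>>0. C = (\<lambda>x. \<tau> *\<^sub>R x) ` C)"
  then have scale: "\<tau> *\<^sub>R x \<in> C" if "\<tau> > 0" "x \<in> C" for \<tau> x
    using that by blast
  obtain x where x: "x \<in> C"
    using C by blast
  have lim: "(\<lambda>n. inverse (real (Suc n)) *\<^sub>R x) \<longlonglongrightarrow> 0 *\<^sub>R x"
    by (intro tendsto_scaleR LIMSEQ_inverse_real_of_nat tendsto_const)
  have "inverse (real (Suc n)) *\<^sub>R x \<in> C" for n
    using x by (intro scale) auto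
  then have "0 *\<^sub>R x \<in> C"
    using closed_sequentially[OF assms _ lim] by blast
  then have "c *\<^sub>R y \<in> C" if "0 \<le> c" "y \<in> C" for c y
    using scale[of c y] that by (cases "c = 0") auto
  then show "convex_cone C"
    using C by (auto simp: convex_cone_def conic_def)
qed

definition polar_cone :: "'a::euclidean_space set \<Rightarrow> 'a set" where
  "polar_cone C = {u. \<forall>x\<in>C. u \<bullet> x \<le> 0}"

text \<open>The empty intersection is allowed, so the whole space is polyhedral.\<close>

definition polyhedral_cone :: "'a::euclidean_space set \<Rightarrow> bool" where
  "polyhedral_cone C \<longleftrightarrow>
     (\<exists>F. finite F \<and> C = \<Inter> F \<and> (\<forall>h\<in>F. \<exists>a. a \<noteq> 0 \<and> h = {x. a \<bullet> x \<le> 0}))"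

text \<open>
  The distribution of a vector with independent standard normal coordinates with respect to
  the orthonormal basis \<^const>\<open>Basis\<close>.
\<close>

definition std_gaussian :: "'a::euclidean_space measure" where
  "std_gaussian = density lborel (\<lambda>x. ennreal (\<Prod>b\<in>Basis. std_normal_density (x \<bullet> b)))"

definition polyhedral_intrinsic_volume :: "nat \<Rightarrow> 'a::euclidean_space set \<Rightarrow> real" where
  "polyhedral_intrinsic_volume k C =
     measure std_gaussian
       {g. \<exists>F. F face_of C \<and> aff_dim F = int k \<and> closest_point C g \<in> rel_interior F}"

text \<open>
  Values in \<^typ>\<open>ennreal\<close> make the Hausdorff distance meaningful for the empty set: it is
  \<open>0\<close> from itself and at distance \<open>\<infinity>\<close> from every nonempty set. So the cone \<open>{0}\<close>, which misses
  the sphere, is an isolated point below. Only convergence in the conic Hausdorff metric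
  matters, and it is the same for the chordal distance on the sphere, used here,
  as for the angular one.
\<close>

definition hausdorff_dist :: "'a::metric_space set \<Rightarrow> 'a set \<Rightarrow> ennreal" where
  "hausdorff_dist S T =
     max (SUP x\<in>S. INF y\<in>T. ennreal (dist x y)) (SUP y\<in>T. INF x\<in>S. ennreal (dist x y))"

definition conic_hausdorff_dist :: "'a::euclidean_space set \<Rightarrow> 'a set \<Rightarrow> ennreal" where
  "conic_hausdorff_dist C D = hausdorff_dist (C \<inter> sphere 0 1) (D \<inter> sphere 0 1)"

text \<open>
  For a non-polyhedral closed convex cone the value is the common limit along all sequences of
  polyhedral cones converging to it.
\<close>

definition intrinsic_volume :: "nat \<Rightarrow> 'a::euclidean_space set \<Rightarrow> real" where
  "intrinsic_volume k C =
     (if polyhedral_cone C then polyhedral_intrinsic_volume k C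
      else (THE v. \<forall>P :: nat \<Rightarrow> 'a set.
              (\<forall>i. polyhedral_cone (P i)) \<longrightarrow>
              (\<lambda>i. conic_hausdorff_dist (P i) C) \<longlonglongrightarrow> 0 \<longrightarrow>
              (\<lambda>i. polyhedral_intrinsic_volume k (P i)) \<longlonglongrightarrow> v))"

definition statistical_dimension :: "'a::euclidean_space set \<Rightarrow> real" where
  "statistical_dimension C = (\<Sum>k=0..DIM('a). real k * intrinsic_volume k C)"

definition tail_functional :: "nat \<Rightarrow> 'a::euclidean_space set \<Rightarrow> real" where
  "tail_functional k C = (\<Sum>j=k..DIM('a). intrinsic_volume j C)"

definition transition_width :: "'a::euclidean_space set \<Rightarrow> real" where
  "transition_width C = sqrt (min (statistical_dimension C) (statistical_dimension (polar_cone C)))"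

text \<open>
  At \<open>\<lambda> = 0\<close> the exponent is \<open>0\<close> also when the transition width vanishes, since \<open>0 / 0 = 0\<close>.
\<close>

definition p_bound :: "'a::euclidean_space set \<Rightarrow> real \<Rightarrow> real" where
  "p_bound C lam = 4 * exp ((- (lam\<^sup>2) / 8) / ((transition_width C)\<^sup>2 + lam))"

end

theory Submission
  imports Defs "HOL-Computational_Algebra.Polynomial"
begin

text \<open>
  Write \<open>\<Pi>\<close> for the projection onto \<open>C\<close> and \<open>G(s) = \<Sum>\<^sub>k v\<^sub>k(C) s\<^sup>k\<close>. For a polyhedral cone, the integral of
  \<open>exp (- (\<bar>\<Pi> x\<bar>\<^sup>2 / s\<^sup>2 + \<bar>x - \<Pi> x\<bar>\<^sup>2 / t\<^sup>2) / 2)\<close> equals \<open>\<Sum>\<^sub>k v\<^sub>k(C) s\<^sup>k t\<^sup>d\<^sup>-\<^sup>k\<close> up to the factor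
  \<open>(2 \<pi>)\<^sup>d\<^sup>/\<^sup>2\<close>: on the set of points projected to the interior of a face it reduces to a linear
  substitution. The integral is continuous in the cone, hence so are the coefficients \<open>v\<^sub>k\<close>; the
  limits defining them exist, and the identity holds for every closed convex cone. Exchanging
  \<open>s\<close> and \<open>t\<close> gives \<open>v\<^sub>k(C\<degree>) = v\<^sub>d\<^sub>-\<^sub>k(C)\<close>.

  The Prekopa-Leindler inequality applied to these integrals yields \<open>G(s) G(s') \<le> 1\<close> whenever
  \<open>s\<^sup>2 + s'\<^sup>2 = 2\<close>. Bounding \<open>G(s')\<close> from below by Jensen's inequality, \<open>G(s') \<ge> s' powr \<delta>(C)\<close>,
  one gets an upper bound for \<open>G(s)\<close>, and Markov's inequality controls both tails in terms of
  \<open>\<delta>(C)\<close>. The same bounds for \<open>C\<degree>\<close> give the minimum of the two statistical dimensions.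
\<close>

section \<open>The Prekopa-Leindler inequality\<close>

lemma emeasure_lborel_SUP_atMost:
  fixes A :: "real set"
  assumes [measurable]: "A \<in> sets borel" and "A \<noteq> {}"
  shows "emeasure lborel A = (SUP a\<in>A. emeasure lborel (A \<inter> {..a}))"
proof (rule antisym)
  let ?S = "SUP a\<in>A. emeasure lborel (A \<inter> {..a})"
  show "?S \<le> emeasure lborel A"
    by (intro SUP_least emeasure_mono) auto
  have below: "emeasure lborel (A \<inter> {..t}) \<le> ?S" if "a \<in> A" "t \<le> a" for a t
    using that by (intro SUP_upper2[of a] emeasure_mono) auto
  show "emeasure lborel A \<le> ?S"
  proof (cases "bdd_above A")
    case False
    \<comment> \<open>Without an upper bound, the truncations at integers exhaust \<open>A\<close>,
      and each of them lies inside a truncation at some point of \<open>A\<close>.\<close>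
    have "emeasure lborel (\<Union>n. A \<inter> {..real n}) = (SUP n. emeasure lborel (A \<inter> {..real n}))"
      by (intro SUP_emeasure_incseq[symmetric]) (auto simp: incseq_def)
    moreover have "(\<Union>n. A \<inter> {..real n}) = A"
      using real_arch_simple by auto
    moreover have "emeasure lborel (A \<inter> {..real n}) \<le> ?S" for n
    proof -
      obtain a where "a \<in> A" "real n \<le> a"
        using False by (meson bdd_above.I linear)
      then show ?thesis by (rule below)
    qed
    ultimately show ?thesis
      by (metis SUP_least)
  next
    case True
    let ?s = "Sup A"
    \<comment> \<open>Truncations strictly below the supremum miss at most the null set
      \<open>{Sup A}\<close>. The supremum itself may fail to belong to \<open>A\<close>, so it
      cannot serve as a cut point.\<close>
    have "emeasure lborel (\<Union>n. A \<inter> {..?s - inverse (real (Suc n))}) =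
        (SUP n. emeasure lborel (A \<inter> {..?s - inverse (real (Suc n))}))"
      by (intro SUP_emeasure_incseq[symmetric])
         (auto simp: incseq_def field_simps intro: order_trans)
    also have "\<dots> \<le> ?S"
    proof (rule SUP_least)
      fix n
      have "?s - inverse (real (Suc n)) < ?s" by simp
      then obtain a where "a \<in> A" "?s - inverse (real (Suc n)) < a"
        using less_cSup_iff[OF assms(2) True] by blast
      then show "emeasure lborel (A \<inter> {..?s - inverse (real (Suc n))}) \<le> ?S"
        by (intro below) auto
    qed
    finally have *: "emeasure lborel (\<Union>n. A \<inter> {..?s - inverse (real (Suc n))}) \<le> ?S" .
    have "A - {?s} \<subseteq> (\<Union>n. A \<inter> {..?s - inverse (real (Suc n))})"
    proof
      fix x assume x: "x \<in> A - {?s}"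
      then have "x < ?s" using cSup_upper[OF _ True, of x] by auto
      then obtain n where "inverse (real (Suc n)) < ?s - x"
        using reals_Archimedean[of "?s - x"] by auto
      then show "x \<in> (\<Union>n. A \<inter> {..?s - inverse (real (Suc n))})"
        using x by (auto intro!: exI[of _ n])
    qed
    then have "emeasure lborel (A - {?s}) \<le> ?S"
      by (intro order_trans[OF emeasure_mono *]) auto
    moreover have "emeasure lborel (A - {?s}) = emeasure lborel A"
      by (intro emeasure_Diff_null_set) auto
    ultimately show ?thesis by simp
  qed
qed

lemma emeasure_lborel_vimage_uminus:
  fixes A :: "real set"
  assumes "A \<in> sets borel"
  shows "emeasure lborel (uminus -` A) = emeasure lborel A"
proof -
  have "emeasure lborel A = emeasure (distr lborel borel uminus) A"
    by (simp add: lborel_distr_uminus)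
  also have "\<dots> = emeasure lborel (uminus -` A)"
    using assms by (subst emeasure_distr) auto
  finally show ?thesis ..
qed

lemma emeasure_lborel_vimage_plus:
  fixes A :: "real set"
  assumes "A \<in> sets borel"
  shows "emeasure lborel ((+) c -` A) = emeasure lborel A"
proof -
  have "emeasure lborel A = emeasure (distr lborel borel ((+) c)) A"
    by (simp add: lborel_distr_plus)
  also have "\<dots> = emeasure lborel ((+) c -` A)"
    using assms by (subst emeasure_distr) auto
  finally show ?thesis ..
qed

lemma emeasure_lborel_SUP_atLeast:
  fixes A :: "real set"
  assumes [measurable]: "A \<in> sets borel" and "A \<noteq> {}"
  shows "emeasure lborel A = (SUP a\<in>A. emeasure lborel (A \<inter> {a..}))"
proof -
  have [measurable]: "uminus -` A \<in> sets borel"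
    using measurable_sets_borel[of uminus borel A] by simp
  have "emeasure lborel (uminus -` A) =
      (SUP a\<in>uminus -` A. emeasure lborel (uminus -` A \<inter> {..a}))"
  proof (rule emeasure_lborel_SUP_atMost)
    obtain a where "a \<in> A" using assms(2) by auto
    then have "- a \<in> uminus -` A" by simp
    then show "uminus -` A \<noteq> {}" by blast
  qed auto
  also have "\<dots> = (SUP a\<in>uminus -` A. emeasure lborel (uminus -` (A \<inter> {-a..})))"
    by (intro SUP_cong refl arg_cong2[where f=emeasure]) auto
  also have "\<dots> = (SUP a\<in>uminus -` A. emeasure lborel (A \<inter> {-a..}))"
    by (subst emeasure_lborel_vimage_uminus) auto
  also have "\<dots> = (SUP a\<in>uminus ` (uminus -` A). emeasure lborel (A \<inter> {a..}))"
    by (simp only: image_image)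
  also have "uminus ` (uminus -` A) = A"
    by (simp add: image_vimage_eq surj_uminus)
  finally show ?thesis
    by (simp add: emeasure_lborel_vimage_uminus)
qed

text \<open>A Borel set \<open>S\<close> containing the sumset is used because the sumset of Borel
  sets need not be Borel. Cutting \<open>A\<close> and \<open>B\<close> at points of their own keeps
  the translates by these points inside \<open>S\<close>; the two supremum lemmas then recover the
  full measures.\<close>

lemma brunn_minkowski_real:
  fixes A B S :: "real set"
  assumes [measurable]: "A \<in> sets borel" "B \<in> sets borel" "S \<in> sets borel"
    and "A \<noteq> {}" "B \<noteq> {}"
    and sum: "\<And>a b. a \<in> A \<Longrightarrow> b \<in> B \<Longrightarrow> a + b \<in> S"
  shows "emeasure lborel A + emeasure lborel B \<le> emeasure lborel S"
proof -
  have cut: "emeasure lborel (A \<inter> {..a}) + emeasure lborel (B \<inter> {b..}) \<le> emeasure lborel S"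
    if "a \<in> A" "b \<in> B" for a b
  proof -
    \<comment> \<open>both translates lie in \<open>S\<close> and meet in at most the point \<open>a + b\<close>\<close>
    let ?A = "(+) (-b) -` (A \<inter> {..a})" and ?B = "(+) (-a) -` (B \<inter> {b..})"
    have [measurable]: "?A \<in> sets borel" "?B \<in> sets borel"
      using measurable_sets_borel[of "(+) (-b)" borel "A \<inter> {..a}"]
        measurable_sets_borel[of "(+) (-a)" borel "B \<inter> {b..}"] by simp_all
    have "emeasure lborel (A \<inter> {..a}) + emeasure lborel (B \<inter> {b..}) =
        emeasure lborel ?A + emeasure lborel ?B"
      by (subst (1 2) emeasure_lborel_vimage_plus) auto
    also have "emeasure lborel ?B = emeasure lborel (?B - {a + b})"
      by (intro emeasure_Diff_null_set[symmetric]) auto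
    also have "emeasure lborel ?A + emeasure lborel (?B - {a + b}) =
        emeasure lborel (?A \<union> (?B - {a + b}))"
      by (intro plus_emeasure) auto
    also have "\<dots> \<le> emeasure lborel S"
    proof (rule emeasure_mono)
      show "?A \<union> (?B - {a + b}) \<subseteq> S"
      proof
        fix z assume "z \<in> ?A \<union> (?B - {a + b})"
        then show "z \<in> S"
          using sum[of "- b + z" b] sum[of a "- a + z"] that by auto
      qed
    qed auto
    finally show ?thesis .
  qed
  have "emeasure lborel A + emeasure lborel (B \<inter> {b..}) \<le> emeasure lborel S" if "b \<in> B" for b
    unfolding emeasure_lborel_SUP_atMost[OF assms(1,4)]
    using cut that assms(4) by (subst ennreal_SUP_add_left[symmetric]) (auto intro!: SUP_least)
  then show ?thesis
    unfolding emeasure_lborel_SUP_atLeast[OF assms(2,5)]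
    using assms(5) by (subst add.commute, subst ennreal_SUP_add_left[symmetric]) (auto intro!: SUP_least simp: add.commute)
qed


text \<open>For \<open>t\<close> in \<open>{0..<1}\<close> the superlevel sets of \<open>f\<close>
  and \<open>g\<close> are nonempty and their sumset lies in that of \<open>h\<close>, so
  Brunn-Minkowski applies at each level and the result is integrated over \<open>t\<close>. The
  normalization to supremum 1 makes the range of nonempty levels the same for both
  functions.\<close>

lemma layer_cake_le:
  fixes f g h :: "real \<Rightarrow> ennreal"
  assumes [measurable]: "f \<in> borel_measurable borel" "g \<in> borel_measurable borel"
      "h \<in> borel_measurable borel"
    and f: "\<And>x. f x \<le> 1" "\<And>t. 0 \<le> t \<Longrightarrow> t < 1 \<Longrightarrow> \<exists>x. ennreal t < f x"
    and g: "\<And>x. g x \<le> 1" "\<And>t. 0 \<le> t \<Longrightarrow> t < 1 \<Longrightarrow> \<exists>x. ennreal t < g x"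
    and h: "\<And>t x y. 0 \<le> t \<Longrightarrow> t < 1 \<Longrightarrow> ennreal t < f x \<Longrightarrow> ennreal t < g y \<Longrightarrow> ennreal t < h (x + y)"
  shows "(\<integral>\<^sup>+x. f x \<partial>lborel) + (\<integral>\<^sup>+x. g x \<partial>lborel) \<le> (\<integral>\<^sup>+x. h x \<partial>lborel)"
proof -
  interpret lborel_pair: pair_sigma_finite "lborel :: real measure" "lborel :: real measure" ..
  \<comment> \<open>The integral of \<open>I u x t\<close> over \<open>t\<close> is the minimum of
    \<open>u x\<close> and 1. This is exact for \<open>f\<close> and \<open>g\<close> and a lower
    bound for \<open>h\<close>, which is the direction required.\<close>
  define I :: "(real \<Rightarrow> ennreal) \<Rightarrow> real \<Rightarrow> real \<Rightarrow> ennreal"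
    where "I u x t = indicator {0..<1} t * indicator {x. ennreal t < u x} x" for u x t
  have [measurable]: "(\<lambda>(x, t). I u x t) \<in> borel_measurable (lborel \<Otimes>\<^sub>M lborel)"
    if [measurable]: "u \<in> borel_measurable borel" for u
    unfolding I_def by measurable
  have eq: "(\<integral>\<^sup>+t. I u x t \<partial>lborel) = u x" if u: "u x \<le> 1" for u x
  proof -
    obtain r where r: "u x = ennreal r" "0 \<le> r" "r \<le> 1"
      using u by (cases "u x") (auto simp: top_unique)
    have "(\<integral>\<^sup>+t. I u x t \<partial>lborel) = (\<integral>\<^sup>+t. indicator {0..<r} t \<partial>lborel)"
      using r by (intro nn_integral_cong) (auto simp: I_def indicator_def ennreal_less_iff)
    then show ?thesis using r by simp
  qed
  have le: "(\<integral>\<^sup>+t. I u x t \<partial>lborel) \<le> u x" for u x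
  proof (cases "u x \<le> 1")
    case False
    have "(\<integral>\<^sup>+t. I u x t \<partial>lborel) \<le> (\<integral>\<^sup>+t. indicator {0..<1::real} t \<partial>lborel)"
      by (intro nn_integral_mono) (auto simp: I_def indicator_def)
    also have "\<dots> \<le> u x" using False by simp
    finally show ?thesis .
  qed (simp add: eq)
  have swap: "(\<integral>\<^sup>+x. (\<integral>\<^sup>+t. I u x t \<partial>lborel) \<partial>lborel) =
      (\<integral>\<^sup>+t. indicator {0..<1} t * emeasure lborel {x. ennreal t < u x} \<partial>lborel)"
    if [measurable]: "u \<in> borel_measurable borel" for u
  proof -
    have "(\<integral>\<^sup>+x. (\<integral>\<^sup>+t. I u x t \<partial>lborel) \<partial>lborel) = (\<integral>\<^sup>+t. (\<integral>\<^sup>+x. I u x t \<partial>lborel) \<partial>lborel)"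
      using lborel_pair.Fubini[of "\<lambda>(x, t). I u x t"] by simp
    also have "\<dots> = (\<integral>\<^sup>+t. indicator {0..<1} t * emeasure lborel {x. ennreal t < u x} \<partial>lborel)"
      unfolding I_def by (intro nn_integral_cong) (simp add: nn_integral_cmult)
    finally show ?thesis .
  qed
  have "(\<integral>\<^sup>+x. f x \<partial>lborel) + (\<integral>\<^sup>+x. g x \<partial>lborel) =
      (\<integral>\<^sup>+t. indicator {0..<1} t * emeasure lborel {x. ennreal t < f x} \<partial>lborel) +
      (\<integral>\<^sup>+t. indicator {0..<1} t * emeasure lborel {x. ennreal t < g x} \<partial>lborel)"
    using swap[of f] swap[of g] eq[OF f(1)] eq[OF g(1)] by simp
  also have "\<dots> = (\<integral>\<^sup>+t. indicator {0..<1} t * emeasure lborel {x. ennreal t < f x} +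
      indicator {0..<1} t * emeasure lborel {x. ennreal t < g x} \<partial>lborel)"
    by (intro nn_integral_add[symmetric]) auto
  also have "\<dots> \<le> (\<integral>\<^sup>+t. indicator {0..<1} t * emeasure lborel {x. ennreal t < h x} \<partial>lborel)"
  proof (intro nn_integral_mono)
    fix t :: real
    have "emeasure lborel {x. ennreal t < f x} + emeasure lborel {x. ennreal t < g x}
        \<le> emeasure lborel {x. ennreal t < h x}" if "0 \<le> t" "t < 1"
      using f(2)[OF that] g(2)[OF that] h[OF that] by (intro brunn_minkowski_real) auto
    then show "indicator {0..<1} t * emeasure lborel {x. ennreal t < f x} +
        indicator {0..<1} t * emeasure lborel {x. ennreal t < g x}
        \<le> indicator {0..<1} t * emeasure lborel {x. ennreal t < h x}"
      by (auto simp: indicator_def)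
  qed
  also have "\<dots> = (\<integral>\<^sup>+x. (\<integral>\<^sup>+t. I h x t \<partial>lborel) \<partial>lborel)"
    by (rule swap[symmetric]) fact
  also have "\<dots> \<le> (\<integral>\<^sup>+x. h x \<partial>lborel)"
    by (intro nn_integral_mono le)
  finally show ?thesis .
qed

text \<open>Dividing \<open>f\<close> and \<open>g\<close> by their suprema leads to the additive
  inequality of \<open>layer_cake_le\<close>; the arithmetic-geometric mean inequality then turns
  the sum of integrals into a product.\<close>

lemma prekopa_leindler_real_bounded:
  fixes f g h :: "real \<Rightarrow> ennreal"
  assumes [measurable]: "f \<in> borel_measurable borel" "g \<in> borel_measurable borel"
      "h \<in> borel_measurable borel"
    and fin: "(SUP x. f x) < top" "(SUP x. g x) < top"
    and le: "\<And>x y. f x * g y \<le> (h (x + y))\<^sup>2"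
  shows "4 * (\<integral>\<^sup>+x. f x \<partial>lborel) * (\<integral>\<^sup>+x. g x \<partial>lborel) \<le> (\<integral>\<^sup>+x. h x \<partial>lborel)\<^sup>2"
proof -
  obtain a b where a: "(SUP x. f x) = ennreal a" "0 \<le> a" and b: "(SUP x. g x) = ennreal b" "0 \<le> b"
    using fin by (cases "SUP x. f x"; cases "SUP x. g x") auto
  have fa: "f x \<le> ennreal a" and gb: "g x \<le> ennreal b" for x
    using a b by (auto intro: SUP_upper simp flip: a(1) b(1))
  show ?thesis
  proof (cases "a = 0 \<or> b = 0")
    case True
    then have "(\<forall>x. f x = 0) \<or> (\<forall>x. g x = 0)"
      using fa gb by (metis ennreal_0 le_zero_eq)
    then show ?thesis by auto
  next
    case False
    then have ab: "0 < a" "0 < b" using a b by auto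
    \<comment> \<open>The geometric mean of the two suprema: dividing \<open>h\<close> by it
      preserves the product hypothesis, and \<open>c\<^sup>2 = a * b\<close> cancels at the
      end.\<close>
    define c where "c = sqrt (a * b)"
    have c: "0 < c" "c\<^sup>2 = a * b" using ab by (auto simp: c_def)
    let ?f = "\<lambda>x. ennreal (1 / a) * f x" and ?g = "\<lambda>x. ennreal (1 / b) * g x"
      and ?h = "\<lambda>x. ennreal (1 / c) * h x"
    have scale: "ennreal t < ennreal (1 / r) * u \<longleftrightarrow> ennreal (t * r) < u" if "0 \<le> t" "0 < r" for t r u
      using that by (cases u) (auto simp: ennreal_mult[symmetric] ennreal_less_iff field_simps ennreal_mult_top)
    have "(\<integral>\<^sup>+x. ?f x \<partial>lborel) + (\<integral>\<^sup>+x. ?g x \<partial>lborel) \<le> (\<integral>\<^sup>+x. ?h x \<partial>lborel)"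
    proof (rule layer_cake_le)
      fix t :: real assume t: "0 \<le> t" "t < 1"
      have "ennreal (t * a) < (SUP x. f x)" "ennreal (t * b) < (SUP x. g x)"
        using a b ab t by (auto simp: ennreal_less_iff)
      then show "\<exists>x. ennreal t < ?f x" "\<exists>x. ennreal t < ?g x"
        using scale ab t by (auto simp: less_SUP_iff)
      fix x y assume "ennreal t < ?f x" "ennreal t < ?g y"
      then have "ennreal (t * a) \<le> f x" "ennreal (t * b) \<le> g y" "ennreal (t * a) < f x" "ennreal (t * b) < g y"
        using t ab by (auto simp: scale)
      then have "ennreal (t * a) * ennreal (t * b) < f x * g y"
        using t ab by (cases "f x"; cases "g y")
          (auto simp: ennreal_mult[symmetric] ennreal_less_iff ennreal_mult_top ennreal_top_mult
             mult_less_0_iff intro!: mult_strict_mono')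
      also have "\<dots> \<le> (h (x + y))\<^sup>2" by (rule le)
      finally have "ennreal ((t * c)\<^sup>2) < (h (x + y))\<^sup>2"
        using t ab c by (simp add: ennreal_mult[symmetric] power_mult_distrib) (simp add: power2_eq_square mult_ac)
      then have "ennreal (t * c) < h (x + y)"
        using t c by (cases "h (x + y)") (auto simp: ennreal_power ennreal_less_iff power2_less_imp_less)
      then show "ennreal t < ?h (x + y)"
        using scale t c by simp
    next
      fix x show "?f x \<le> 1" "?g x \<le> 1"
        using fa[of x] gb[of x] ab
        by (cases "f x"; cases "g x"; auto simp: ennreal_mult[symmetric] field_simps top_unique)+
    qed auto
    then have sum: "ennreal (1 / a) * (\<integral>\<^sup>+x. f x \<partial>lborel) + ennreal (1 / b) * (\<integral>\<^sup>+x. g x \<partial>lborel)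
        \<le> ennreal (1 / c) * (\<integral>\<^sup>+x. h x \<partial>lborel)"
      by (simp add: nn_integral_cmult)
    show ?thesis
    proof (cases "(\<integral>\<^sup>+x. h x \<partial>lborel) = top")
      case True
      then show ?thesis by (simp add: power2_eq_square)
    next
      case False
      then obtain H where H: "(\<integral>\<^sup>+x. h x \<partial>lborel) = ennreal H" "0 \<le> H"
        by (cases "\<integral>\<^sup>+x. h x \<partial>lborel") auto
      obtain F G where F: "(\<integral>\<^sup>+x. f x \<partial>lborel) = ennreal F" "0 \<le> F"
        and G: "(\<integral>\<^sup>+x. g x \<partial>lborel) = ennreal G" "0 \<le> G"
        using sum ab c unfolding H
        by (cases "\<integral>\<^sup>+x. f x \<partial>lborel"; cases "\<integral>\<^sup>+x. g x \<partial>lborel")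
           (auto simp: ennreal_mult_top top_unique ennreal_mult_eq_top_iff)
      have *: "F / a + G / b \<le> H / c"
        using sum ab c F(2) G(2) H(2) unfolding H F G
        by (simp add: ennreal_mult[symmetric] ennreal_plus[symmetric] del: ennreal_plus)
      have "4 * x * y \<le> (x + y)\<^sup>2" for x y :: real
        using zero_le_power2[of "x - y"] by (simp add: power2_eq_square algebra_simps)
      then have "4 * (F / a) * (G / b) \<le> (F / a + G / b)\<^sup>2" .
      also have "\<dots> \<le> (H / c)\<^sup>2"
        using * ab F G by (intro power_mono) auto
      finally have "4 * F * G \<le> H\<^sup>2"
        using ab c by (simp add: power_divide field_simps)
      then show ?thesis
        using F G H by (simp add: ennreal_mult[symmetric] ennreal_power flip: ennreal_numeral)
    qed
  qed
qed

text \<open>Truncating \<open>f\<close> and \<open>g\<close> by constants makes the suprema finite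
  and preserves the hypothesis with the same \<open>h\<close>; monotone convergence removes the
  truncation.\<close>

lemma prekopa_leindler_real:
  fixes f g h :: "real \<Rightarrow> ennreal"
  assumes [measurable]: "f \<in> borel_measurable borel" "g \<in> borel_measurable borel"
      "h \<in> borel_measurable borel"
    and le: "\<And>x y. f x * g y \<le> (h (x + y))\<^sup>2"
  shows "4 * (\<integral>\<^sup>+x. f x \<partial>lborel) * (\<integral>\<^sup>+x. g x \<partial>lborel) \<le> (\<integral>\<^sup>+x. h x \<partial>lborel)\<^sup>2"
proof -
  have trunc: "(\<integral>\<^sup>+x. u x \<partial>lborel) = (SUP n. \<integral>\<^sup>+x. min (u x) (of_nat n) \<partial>lborel)"
    if [measurable]: "u \<in> borel_measurable borel" for u :: "real \<Rightarrow> ennreal"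
  proof -
    have "(SUP n. min (u x) (of_nat n)) = u x" for x
    proof -
      have "(SUP n. min (u x) (of_nat n)) = inf (u x) (SUP n. of_nat n)"
        by (simp add: inf_SUP flip: inf_min)
      then show ?thesis by (simp add: ennreal_SUP_of_nat_eq_top)
    qed
    then have "(\<integral>\<^sup>+x. u x \<partial>lborel) = (\<integral>\<^sup>+x. (SUP n. min (u x) (of_nat n)) \<partial>lborel)" by simp
    also have "\<dots> = (SUP n. \<integral>\<^sup>+x. min (u x) (of_nat n) \<partial>lborel)"
      by (intro nn_integral_monotone_convergence_SUP)
         (auto simp: incseq_def le_fun_def intro!: min.coboundedI2 of_nat_mono)
    finally show ?thesis .
  qed
  have bound: "4 * (\<integral>\<^sup>+x. min (f x) (of_nat m) \<partial>lborel) * (\<integral>\<^sup>+x. min (g x) (of_nat n) \<partial>lborel)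
      \<le> (\<integral>\<^sup>+x. h x \<partial>lborel)\<^sup>2" for m n
  proof (rule prekopa_leindler_real_bounded)
    have "(SUP x. min (u x) (of_nat k)) < (top :: ennreal)" for u :: "real \<Rightarrow> ennreal" and k
      by (rule le_less_trans[of _ "of_nat k"]) (auto intro!: SUP_least simp: of_nat_less_top)
    then show "(SUP x. min (f x) (of_nat m)) < top" "(SUP x. min (g x) (of_nat n)) < top" by auto
    show "min (f x) (of_nat m) * min (g y) (of_nat n) \<le> (h (x + y))\<^sup>2" for x y
      by (rule order_trans[OF mult_mono le]) auto
  qed auto
  show ?thesis
    unfolding trunc[OF assms(1)] trunc[OF assms(2)] SUP_mult_left_ennreal SUP_mult_right_ennreal
    by (intro SUP_least bound)
qed

section \<open>Tensorization to several variables\<close>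

text \<open>
  With \<open>x + y\<close> in place of the midpoint, the factor \<open>4 ^ d\<close> replaces the rescaling of \<open>h\<close>.
\<close>

lemma prekopa_leindler_PiM:
  fixes f g h :: "('i \<Rightarrow> real) \<Rightarrow> ennreal"
  assumes "finite I"
    and "f \<in> borel_measurable (Pi\<^sub>M I (\<lambda>_. lborel))" "g \<in> borel_measurable (Pi\<^sub>M I (\<lambda>_. lborel))"
      "h \<in> borel_measurable (Pi\<^sub>M I (\<lambda>_. lborel))"
    and "\<And>x y. x \<in> space (Pi\<^sub>M I (\<lambda>_. lborel)) \<Longrightarrow> y \<in> space (Pi\<^sub>M I (\<lambda>_. lborel)) \<Longrightarrow>
      f x * g y \<le> (h (\<lambda>i\<in>I. x i + y i))\<^sup>2"
  shows "4 ^ card I * (\<integral>\<^sup>+x. f x \<partial>Pi\<^sub>M I (\<lambda>_. lborel)) * (\<integral>\<^sup>+x. g x \<partial>Pi\<^sub>M I (\<lambda>_. lborel))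
    \<le> (\<integral>\<^sup>+x. h x \<partial>Pi\<^sub>M I (\<lambda>_. lborel))\<^sup>2"
  using assms
proof (induction I arbitrary: f g h rule: finite_induct)
  case empty
  interpret product_sigma_finite "\<lambda>_ :: 'i. lborel :: real measure" ..
  show ?case
    using empty.prems(4)[of "\<lambda>_. undefined" "\<lambda>_. undefined"]
    by (simp add: nn_integral_empty space_PiM restrict_def)
next
  case (insert i I)
  interpret product_sigma_finite "\<lambda>_ :: 'i. lborel :: real measure" ..
  note meas = insert.prems(1-3)
  let ?M = "\<lambda>J. Pi\<^sub>M J (\<lambda>_ :: 'i. lborel :: real measure)"
  define S where "S u x = (\<integral>\<^sup>+y. u (x(i := y)) \<partial>lborel)" for u :: "('i \<Rightarrow> real) \<Rightarrow> ennreal" and x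
  have joint: "(\<lambda>(x, y). u (x(i := y))) \<in> borel_measurable (?M I \<Otimes>\<^sub>M lborel)"
    if "u \<in> borel_measurable (?M (insert i I))" for u :: "('i \<Rightarrow> real) \<Rightarrow> ennreal"
    using measurable_compose[OF measurable_add_dim that] by (simp add: split_beta')
  have S_meas: "S u \<in> borel_measurable (?M I)"
    if "u \<in> borel_measurable (?M (insert i I))" for u
    unfolding S_def using joint[OF that] by measurable
  have slice: "(\<lambda>y. u (x(i := y))) \<in> borel_measurable borel"
    if "u \<in> borel_measurable (?M (insert i I))" "x \<in> space (?M I)" for u :: "('i \<Rightarrow> real) \<Rightarrow> ennreal" and x
    using measurable_Pair2[OF joint[OF that(1)] that(2)] by simp
  have int: "(\<integral>\<^sup>+x. u x \<partial>?M (insert i I)) = (\<integral>\<^sup>+x. S u x \<partial>?M I)"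
    if "u \<in> borel_measurable (?M (insert i I))" for u
    unfolding S_def using insert.hyps that by (intro product_nn_integral_insert)
  \<comment> \<open>The factor 4 of the one-dimensional inequality is moved into the first function.
    The pointwise hypothesis for the functions with coordinate \<open>i\<close> integrated out is
    then exactly \<open>prekopa_leindler_real\<close> on the slices.\<close>
  have "4 ^ card I * (\<integral>\<^sup>+x. 4 * S f x \<partial>?M I) * (\<integral>\<^sup>+x. S g x \<partial>?M I) \<le> (\<integral>\<^sup>+x. S h x \<partial>?M I)\<^sup>2"
  proof (rule insert.IH)
    fix x y assume xy: "x \<in> space (?M I)" "y \<in> space (?M I)"
    have z: "(\<lambda>j\<in>I. x j + y j) \<in> space (?M I)" by (auto simp: space_PiM)
    show "4 * S f x * S g y \<le> (S h (\<lambda>j\<in>I. x j + y j))\<^sup>2"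
      unfolding S_def
    proof (rule prekopa_leindler_real[OF slice[OF meas(1) xy(1)] slice[OF meas(2) xy(2)] slice[OF meas(3) z]])
      fix s t
      have "(\<lambda>j\<in>insert i I. (x(i := s)) j + (y(i := t)) j) = (\<lambda>j\<in>I. x j + y j)(i := s + t)"
        using insert.hyps by (auto simp: restrict_def fun_eq_iff)
      moreover have "x(i := s) \<in> space (?M (insert i I))" "y(i := t) \<in> space (?M (insert i I))"
        using xy by (auto simp: space_PiM PiE_iff extensional_def)
      ultimately show "f (x(i := s)) * g (y(i := t)) \<le> (h ((\<lambda>j\<in>I. x j + y j)(i := s + t)))\<^sup>2"
        using insert.prems(4) by metis
    qed
  qed (intro borel_measurable_times_ennreal borel_measurable_const S_meas meas)+
  moreover have "(\<integral>\<^sup>+x. 4 * S f x \<partial>?M I) = 4 * (\<integral>\<^sup>+x. S f x \<partial>?M I)"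
    by (rule nn_integral_cmult[OF S_meas[OF meas(1)]])
  ultimately show ?case
    using insert.hyps meas by (simp add: int mult_ac)
qed

theorem prekopa_leindler:
  fixes f g h :: "'a::euclidean_space \<Rightarrow> ennreal"
  assumes [measurable]: "f \<in> borel_measurable borel" "g \<in> borel_measurable borel"
      "h \<in> borel_measurable borel"
    and le: "\<And>x y. f x * g y \<le> (h (x + y))\<^sup>2"
  shows "4 ^ DIM('a) * (\<integral>\<^sup>+x. f x \<partial>lborel) * (\<integral>\<^sup>+x. g x \<partial>lborel) \<le> (\<integral>\<^sup>+x. h x \<partial>lborel)\<^sup>2"
proof -
  let ?M = "Pi\<^sub>M (Basis :: 'a set) (\<lambda>_. lborel :: real measure)"
  define E :: "('a \<Rightarrow> real) \<Rightarrow> 'a" where "E x = (\<Sum>b\<in>Basis. x b *\<^sub>R b)" for x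
  have [measurable]: "E \<in> measurable ?M borel"
    unfolding E_def by measurable
  have int: "(\<integral>\<^sup>+x. u x \<partial>lborel) = (\<integral>\<^sup>+x. u (E x) \<partial>?M)"
    if [measurable]: "u \<in> borel_measurable borel" for u :: "'a \<Rightarrow> ennreal"
    unfolding lborel_eq[where 'a='a] E_def[symmetric] by (subst nn_integral_distr) auto
  have "E (\<lambda>i\<in>Basis. x i + y i) = E x + E y" for x y
    by (simp add: E_def scaleR_add_left sum.distrib)
  then show ?thesis
    unfolding int[OF assms(1)] int[OF assms(2)] int[OF assms(3)]
    by (intro prekopa_leindler_PiM) (auto simp: le)
qed

section \<open>Gaussian integrals and linear substitutions\<close>

lemma nn_integral_exp_square:
  fixes m :: real
  assumes "m > 0"
  shows "(\<integral>\<^sup>+x. ennreal (exp (- (m / 2) * x\<^sup>2)) \<partial>lborel) = ennreal (sqrt (2 * pi / m))"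
proof -
  let ?\<sigma> = "1 / sqrt m"
  interpret prob_space "density lborel (normal_density 0 ?\<sigma>)"
    using assms by (intro prob_space_normal_density) auto
  have "(\<integral>\<^sup>+x. ennreal (normal_density 0 ?\<sigma> x) \<partial>lborel) = 1"
    using emeasure_space_1 by (simp add: emeasure_density)
  moreover have "exp (- (m / 2) * x\<^sup>2) = sqrt (2 * pi / m) * normal_density 0 ?\<sigma> x" for x
    using assms by (simp add: normal_density_def power_divide field_simps)
  ultimately show ?thesis
    using assms by (simp add: ennreal_mult nn_integral_cmult)
qed

lemma norm_power2_Basis: "(norm x)\<^sup>2 = (\<Sum>b\<in>Basis. (x \<bullet> b)\<^sup>2)" for x :: "'a::euclidean_space"
  unfolding power2_norm_eq_inner by (simp only: euclidean_inner[of x x] power2_eq_square)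

lemma nn_integral_exp_norm_square:
  fixes m :: real
  assumes "m > 0"
  shows "(\<integral>\<^sup>+x. ennreal (exp (- (m / 2) * (norm x)\<^sup>2)) \<partial>(lborel :: 'a::euclidean_space measure))
    = ennreal (sqrt (2 * pi / m) ^ DIM('a))"
proof -
  have "exp (- (m / 2) * (norm x)\<^sup>2) = (\<Prod>b\<in>Basis. exp (- (m / 2) * (x \<bullet> b)\<^sup>2))" for x :: 'a
    unfolding norm_power2_Basis sum_distrib_left by (rule exp_sum) simp
  then have "(\<integral>\<^sup>+x. ennreal (exp (- (m / 2) * (norm x)\<^sup>2)) \<partial>(lborel :: 'a measure)) =
      (\<integral>\<^sup>+x. (\<Prod>b\<in>Basis. ennreal (exp (- (m / 2) * (x \<bullet> b)\<^sup>2))) \<partial>(lborel :: 'a measure))"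
    by (simp add: prod_ennreal)
  also have "\<dots> = (\<Prod>b\<in>(Basis :: 'a set). ennreal (sqrt (2 * pi / m)))"
    using nn_integral_exp_square[OF assms]
    by (subst nn_integral_lborel_prod) auto
  finally show ?thesis
    using assms by (simp add: ennreal_power)
qed

lemma std_gaussian_density:
  "(\<Prod>b\<in>Basis. std_normal_density (x \<bullet> b)) =
    exp (- (norm x)\<^sup>2 / 2) / sqrt (2 * pi) ^ DIM('a)" for x :: "'a::euclidean_space"
proof -
  have "exp (- (norm x)\<^sup>2 / 2) = (\<Prod>b\<in>Basis. exp (- (x \<bullet> b)\<^sup>2 / 2))"
    unfolding norm_power2_Basis sum_negf[symmetric] sum_divide_distrib by (rule exp_sum) simp
  then show ?thesis
    by (simp add: std_normal_density_def prod_dividef)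
qed

section \<open>Linear changes of variables for Lebesgue measure\<close>

lemma borel_measurable_linear:
  fixes f :: "'a::euclidean_space \<Rightarrow> 'b::real_normed_vector"
  assumes "linear f"
  shows "f \<in> borel_measurable borel"
  using assms by (intro borel_measurable_continuous_onI linear_continuous_on linear_conv_bounded_linear[THEN iffD1])

lemma nn_integral_lborel_translate:
  fixes f :: "'a::euclidean_space \<Rightarrow> ennreal"
  assumes [measurable]: "f \<in> borel_measurable borel"
  shows "(\<integral>\<^sup>+x. f (a + x) \<partial>lborel) = (\<integral>\<^sup>+x. f x \<partial>lborel)"
  by (subst (2) lborel_distr_plus[of a, symmetric]) (simp add: nn_integral_distr)

lemma nn_integral_lborel_reflect:
  fixes f :: "'a::euclidean_space \<Rightarrow> ennreal"
  assumes [measurable]: "f \<in> borel_measurable borel"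
  shows "(\<integral>\<^sup>+x. f (a - x) \<partial>lborel) = (\<integral>\<^sup>+x. f x \<partial>lborel)"
  by (subst (2) lborel_affine[of "-1" a]) (simp_all add: nn_integral_density nn_integral_distr)

text \<open>
  Integrating \<open>u (R x)\<close> against the indicator of the unit ball and translating in each of the two
  variables identifies both sides up to the factor \<open>vol (R\<^sup>-\<^sup>1 ball) / vol ball\<close>, which is \<open>1\<close>.
\<close>

lemma nn_integral_lborel_orthogonal_transformation:
  fixes u :: "'a::euclidean_space \<Rightarrow> ennreal" and R :: "'a \<Rightarrow> 'a"
  assumes R: "orthogonal_transformation R" and [measurable]: "u \<in> borel_measurable borel"
  shows "(\<integral>\<^sup>+x. u (R x) \<partial>lborel) = (\<integral>\<^sup>+x. u x \<partial>lborel)"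
proof -
  interpret lborel_pair: pair_sigma_finite "lborel :: 'a measure" "lborel :: 'a measure" ..
  have lin: "linear R" using R by (simp add: orthogonal_transformation_def)
  have [measurable]: "R \<in> borel_measurable borel"
    by (rule borel_measurable_linear) fact
  have [measurable]: "ball (0::'a) 1 \<in> sets borel" by simp
  let ?A = "indicator (ball 0 1) :: 'a \<Rightarrow> ennreal"
  let ?c = "emeasure lborel (ball 0 1 :: 'a set)"
  have "(\<integral>\<^sup>+x. u (R x) \<partial>lborel) * ?c = (\<integral>\<^sup>+x. u (R x) * (\<integral>\<^sup>+y. ?A y \<partial>lborel) \<partial>lborel)"
    by (simp add: nn_integral_multc)
  also have "\<dots> = (\<integral>\<^sup>+x. u (R x) * (\<integral>\<^sup>+y. ?A (R x + y) \<partial>lborel) \<partial>lborel)"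
    by (simp only: nn_integral_lborel_translate[of ?A] borel_measurable_indicator borel_open open_ball)
  also have "\<dots> = (\<integral>\<^sup>+x. (\<integral>\<^sup>+y. u (R x) * ?A (R x + y) \<partial>lborel) \<partial>lborel)"
    by (intro nn_integral_cong nn_integral_cmult[symmetric]) measurable
  also have "\<dots> = (\<integral>\<^sup>+y. (\<integral>\<^sup>+x. u (R x) * ?A (R x + y) \<partial>lborel) \<partial>lborel)"
    by (rule lborel_pair.Fubini'[symmetric]) simp
  \<comment> \<open>Shifting \<open>x\<close> by \<open>- w\<close>, where \<open>R w = y\<close>,
    replaces \<open>R x\<close> by \<open>R x - y\<close> and so moves \<open>y\<close> from the
    ball indicator into \<open>u\<close>.\<close>
  also have "\<dots> = (\<integral>\<^sup>+y. (\<integral>\<^sup>+x. u (R x - y) * ?A (R x) \<partial>lborel) \<partial>lborel)"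
  proof (rule nn_integral_cong)
    fix y
    obtain w where "R w = y"
      using orthogonal_transformation_surj[OF R] by (metis surjD)
    then have "R (- w + x) = R x - y" for x
      by (simp add: linear_diff[OF lin])
    then show "(\<integral>\<^sup>+x. u (R x) * ?A (R x + y) \<partial>lborel) = (\<integral>\<^sup>+x. u (R x - y) * ?A (R x) \<partial>lborel)"
      using nn_integral_lborel_translate[of "\<lambda>x. u (R x) * ?A (R x + y)" "- w"] by simp
  qed
  also have "\<dots> = (\<integral>\<^sup>+x. (\<integral>\<^sup>+y. u (R x - y) * ?A (R x) \<partial>lborel) \<partial>lborel)"
    by (rule lborel_pair.Fubini'[symmetric]) simp
  also have "\<dots> = (\<integral>\<^sup>+x. (\<integral>\<^sup>+y. u (R x - y) \<partial>lborel) * ?A (R x) \<partial>lborel)"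
    by (intro nn_integral_cong nn_integral_multc) simp
  \<comment> \<open>The reflection in \<open>y\<close> removes \<open>R x\<close> from the argument
    of \<open>u\<close>, and the indicator of the ball is unchanged by \<open>R\<close> because
    \<open>R\<close> preserves norms.\<close>
  also have "\<dots> = (\<integral>\<^sup>+x. (\<integral>\<^sup>+y. u y \<partial>lborel) * ?A x \<partial>lborel)"
    using R by (subst nn_integral_lborel_reflect) (auto simp: indicator_def orthogonal_transformation_norm)
  also have "\<dots> = (\<integral>\<^sup>+x. u x \<partial>lborel) * ?c"
    by (simp add: nn_integral_cmult)
  finally have *: "(\<integral>\<^sup>+x. u (R x) \<partial>lborel) * ?c = (\<integral>\<^sup>+x. u x \<partial>lborel) * ?c" .
  have "?c \<noteq> top"
    using emeasure_lborel_ball_finite[of "0::'a" 1] by auto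
  moreover have "?c \<noteq> 0"
    using content_ball_gt_0_iff[of "0::'a" 1] by (auto simp: measure_def)
  ultimately show ?thesis
    using * by (simp add: mult.commute[of _ ?c] ennreal_mult_cancel_left)
qed

text \<open>The substitution is a diagonal map \<open>D\<close> conjugated by the orthogonal map
  \<open>R\<close> that carries \<open>Basis\<close> to the vectors \<open>q b\<close>. Orthogonal
  maps preserve Lebesgue measure, so only the product of the diagonal entries remains.\<close>

lemma nn_integral_lborel_orthonormal_scaling:
  fixes f :: "'a::euclidean_space \<Rightarrow> ennreal" and q :: "'a \<Rightarrow> 'a"
  assumes [measurable]: "f \<in> borel_measurable borel"
    and q: "\<And>b b'. b \<in> Basis \<Longrightarrow> b' \<in> Basis \<Longrightarrow> q b \<bullet> q b' = (if b = b' then 1 else 0)"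
    and c: "\<And>b. b \<in> Basis \<Longrightarrow> c b > 0"
  shows "(\<integral>\<^sup>+x. f x \<partial>lborel) =
    ennreal (\<Prod>b\<in>Basis. c b) * (\<integral>\<^sup>+x. f (\<Sum>b\<in>Basis. (c b * (x \<bullet> q b)) *\<^sub>R q b) \<partial>lborel)"
proof -
  define R where "R x = (\<Sum>b\<in>Basis. (x \<bullet> b) *\<^sub>R q b)" for x
  define D where "D x = (\<Sum>b\<in>Basis. (c b * (x \<bullet> b)) *\<^sub>R b)" for x :: 'a
  have lin: "linear R" "linear D"
    unfolding R_def D_def
    by (auto intro!: linearI simp: inner_add_left scaleR_add_left sum.distrib scaleR_sum_right algebra_simps)
  have Rq: "R x \<bullet> q b = x \<bullet> b" if "b \<in> Basis" for x b
    using that by (simp add: R_def inner_sum_left q if_distrib[of "(*) _"] cong: if_cong)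
  have Rb: "R b = q b" if "b \<in> Basis" for b
    using that by (simp add: R_def inner_Basis if_distrib[of "\<lambda>r. r *\<^sub>R _"] cong: if_cong)
  have "R x \<bullet> R y = x \<bullet> y" for x y
  proof -
    have "R x \<bullet> R y = (\<Sum>b\<in>Basis. (y \<bullet> b) * (R x \<bullet> q b))"
      by (subst R_def[of y]) (simp add: inner_sum_right)
    then show ?thesis
      by (simp add: Rq euclidean_inner[of x y] mult.commute)
  qed
  then have R: "orthogonal_transformation R"
    using lin by (simp add: orthogonal_transformation_def)
  have [measurable]: "R \<in> borel_measurable borel" "D \<in> borel_measurable borel"
    using lin by (auto intro: borel_measurable_linear)
  have "(\<Sum>b\<in>Basis. (c b * (R x \<bullet> q b)) *\<^sub>R q b) = R (D x)" for x
    by (simp add: Rq Rb D_def linear_sum[OF lin(1)] linear_scale[OF lin(1)])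
  then have "(\<integral>\<^sup>+x. f (\<Sum>b\<in>Basis. (c b * (x \<bullet> q b)) *\<^sub>R q b) \<partial>lborel) = (\<integral>\<^sup>+x. f (R (D x)) \<partial>lborel)"
    using nn_integral_lborel_orthogonal_transformation[OF R, of "\<lambda>x. f (\<Sum>b\<in>Basis. (c b * (x \<bullet> q b)) *\<^sub>R q b)"]
    by simp
  moreover have "(\<integral>\<^sup>+x. f (R x) \<partial>lborel) = ennreal (\<Prod>b\<in>Basis. c b) * (\<integral>\<^sup>+x. f (R (D x)) \<partial>lborel)"
    using c by (subst lborel_affine_euclidean[of c 0])
      (auto simp: nn_integral_density nn_integral_distr nn_integral_cmult D_def[symmetric] less_imp_neq[THEN not_sym]
         abs_of_pos intro!: arg_cong2[where f="(*)"] arg_cong[where f=ennreal] prod.cong)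
  ultimately show ?thesis
    using nn_integral_lborel_orthogonal_transformation[OF R, of f] by simp
qed

text \<open>An orthonormal basis of \<open>L\<close> joined with one of its orthogonal complement
  diagonalizes \<open>T\<close>, so the Jacobian is read off from the two dimensions. The lemma is
  meant for the span of a face, where \<open>T\<close> scales the projection and the residual
  separately.\<close>

lemma subspace_scaling_exists:
  fixes L :: "'a::euclidean_space set"
  assumes L: "subspace L" and st: "s > 0" "t > 0"
  obtains T where "linear T" "inj T" "\<And>p. p \<in> L \<Longrightarrow> T p = s *\<^sub>R p"
    "\<And>p. (\<And>x. x \<in> L \<Longrightarrow> p \<bullet> x = 0) \<Longrightarrow> T p = t *\<^sub>R p"
    "\<And>f :: 'a \<Rightarrow> ennreal. f \<in> borel_measurable borel \<Longrightarrow>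
      (\<integral>\<^sup>+x. f x \<partial>lborel) = ennreal (s ^ dim L * t ^ (DIM('a) - dim L)) * (\<integral>\<^sup>+x. f (T x) \<partial>lborel)"
proof -
  define N where "N = {y. \<forall>x\<in>L. orthogonal x y}"
  have N: "subspace N"
    unfolding N_def orthogonal_def by (auto intro!: subspaceI simp: inner_add_right)
  obtain B1 where B1: "B1 \<subseteq> L" "pairwise orthogonal B1" "\<And>x. x \<in> B1 \<Longrightarrow> norm x = 1"
      "independent B1" "card B1 = dim L" "span B1 = L"
    using orthonormal_basis_subspace[OF L] by blast
  obtain B2 where B2: "B2 \<subseteq> N" "pairwise orthogonal B2" "\<And>x. x \<in> B2 \<Longrightarrow> norm x = 1"
      "independent B2" "card B2 = dim N" "span B2 = N"
    using orthonormal_basis_subspace[OF N] by blast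
  have fin: "finite B1" "finite B2"
    using B1(4) B2(4) independent_imp_finite by auto
  have "dim N + dim L = DIM('a)"
    using dim_subspace_orthogonal_to_vectors[OF L subspace_UNIV] by (simp add: N_def)
  then have dimN: "dim N = DIM('a) - dim L" "dim L + dim N = DIM('a)" by auto
  have cross: "orthogonal x y" if "x \<in> B1" "y \<in> B2" for x y
    using that B1(1) B2(1) by (auto simp: N_def)
  have disj: "B1 \<inter> B2 = {}"
    using cross B1(3) by (auto simp: orthogonal_def dot_square_norm) (metis IntI disjoint_iff zero_neq_one one_power2 power2_norm_eq_inner)
  have card: "card (B1 \<union> B2) = DIM('a)"
    using fin B1(5) B2(5) disj dimN(2) by (simp add: card_Un_disjoint)
  obtain q where q: "bij_betw q (Basis :: 'a set) (B1 \<union> B2)"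
    using finite_same_card_bij[of "Basis :: 'a set" "B1 \<union> B2"] fin card by auto
  have orth: "x \<bullet> y = (if x = y then 1 else 0)" if "x \<in> B1 \<union> B2" "y \<in> B1 \<union> B2" for x y
    using that B1(2,3) B2(2,3) cross
    by (auto simp: pairwise_def orthogonal_def norm_eq_1 inner_commute)
       (metis inner_commute)+
  define c where "c b = (if q b \<in> B1 then s else t)" for b
  define T where "T x = (\<Sum>b\<in>Basis. (c b * (x \<bullet> q b)) *\<^sub>R q b)" for x
  have Tsum: "T x = (\<Sum>y\<in>B1 \<union> B2. ((if y \<in> B1 then s else t) * (x \<bullet> y)) *\<^sub>R y)" for x
    unfolding T_def c_def using sum.reindex_bij_betw[OF q, of "\<lambda>y. ((if y \<in> B1 then s else t) * (x \<bullet> y)) *\<^sub>R y"]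
    by simp
  have lin: "linear T"
    unfolding T_def
    by (auto intro!: linearI simp: inner_add_left scaleR_add_left sum.distrib scaleR_sum_right algebra_simps)
  have TB: "T y = (if y \<in> B1 then s else t) *\<^sub>R y" if "y \<in> B1 \<union> B2" for y
  proof -
    have "T y = (\<Sum>z\<in>B1 \<union> B2. if z = y then (if y \<in> B1 then s else t) *\<^sub>R y else 0)"
      unfolding Tsum using that orth by (intro sum.cong) auto
    then show ?thesis using that fin by simp
  qed
  have TB2: "T y = t *\<^sub>R y" if "y \<in> B2" for y
    using TB[of y] that disj by (auto simp: disjoint_iff)
  have TL: "T p = s *\<^sub>R p" if "p \<in> L" for p
    using linear_eq_on[OF lin linear_scale_self, of p B1 s] TB B1(6) that by auto
  have TN: "T p = t *\<^sub>R p" if "\<And>x. x \<in> L \<Longrightarrow> p \<bullet> x = 0" for p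
  proof -
    have "p \<in> span B2"
      using that B2(6) by (auto simp: N_def orthogonal_def inner_commute)
    then show ?thesis
      using linear_eq_on[OF lin linear_scale_self, of p B2 t] TB2 by blast
  qed
  have "x = 0" if "T x = 0" for x
  proof -
    obtain y z where yz: "y \<in> L" "\<And>w. w \<in> L \<Longrightarrow> z \<bullet> w = 0" "x = y + z"
      using orthogonal_subspace_decomp_exists[of L x] L by (metis orthogonal_def span_eq_iff)
    then have "s *\<^sub>R y + t *\<^sub>R z = 0"
      using that TL TN linear_add[OF lin] by simp
    then have "(s *\<^sub>R y + t *\<^sub>R z) \<bullet> y = 0" "(s *\<^sub>R y + t *\<^sub>R z) \<bullet> z = 0" by simp_all
    then show "x = 0"
      using yz(2)[OF yz(1)] yz(3) st by (simp add: inner_add_left inner_commute[of y z])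
  qed
  then have "inj T"
    using linear_injective_0[OF lin] by blast
  show ?thesis
  proof (rule that[of T])
    show "linear T" "inj T" by fact+
    show "T p = s *\<^sub>R p" if "p \<in> L" for p
      using TL that .
    show "T p = t *\<^sub>R p" if "\<And>x. x \<in> L \<Longrightarrow> p \<bullet> x = 0" for p
      using TN that .
    fix f :: "'a \<Rightarrow> ennreal" assume f: "f \<in> borel_measurable borel"
    have "(\<Prod>b\<in>Basis. c b) = (\<Prod>y\<in>B1 \<union> B2. if y \<in> B1 then s else t)"
      unfolding c_def by (rule prod.reindex_bij_betw[OF q])
    also have "\<dots> = (\<Prod>y\<in>B1. if y \<in> B1 then s else t) * (\<Prod>y\<in>B2. if y \<in> B1 then s else t)"
      using fin disj by (intro prod.union_disjoint) auto
    also have "(\<Prod>y\<in>B1. if y \<in> B1 then s else t) = s ^ card B1"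
      by simp
    also have "(\<Prod>y\<in>B2. if y \<in> B1 then s else t) = (\<Prod>y\<in>B2. t)"
      using disj by (intro prod.cong) auto
    finally have "(\<Prod>b\<in>Basis. c b) = s ^ dim L * t ^ (DIM('a) - dim L)"
      using B1(5) B2(5) dimN(1) by simp
    then show "(\<integral>\<^sup>+x. f x \<partial>lborel) =
        ennreal (s ^ dim L * t ^ (DIM('a) - dim L)) * (\<integral>\<^sup>+x. f (T x) \<partial>lborel)"
      unfolding T_def
      using nn_integral_lborel_orthonormal_scaling[of f q c] f orth bij_betwE[OF q] st
        bij_betw_imp_inj_on[OF q]
      by (auto simp: c_def inj_on_eq_iff)
  qed
qed

section \<open>Projections onto convex cones\<close>

text \<open>The variational inequality of the nearest point, tested at the origin and at twice the
  projection, gives orthogonality; combined with it, the same inequality bounds the residual against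
  every \<open>y\<close> in \<open>C\<close>.\<close>

lemma cone_closest_point:
  fixes C :: "'a::euclidean_space set"
  assumes "closed C" "convex_cone C"
  shows cone_closest_point_in: "closest_point C x \<in> C"
    and cone_closest_point_orthogonal: "(x - closest_point C x) \<bullet> closest_point C x = 0"
    and cone_closest_point_dot_le: "\<And>y. y \<in> C \<Longrightarrow> (x - closest_point C x) \<bullet> y \<le> 0"
proof -
  let ?p = "closest_point C x"
  have C: "convex C" "C \<noteq> {}" "0 \<in> C"
    using assms(2) by (auto simp: convex_cone_def intro: convex_cone_contains_0[OF assms(2)])
  show p: "?p \<in> C" using closest_point_in_set assms C by blast
  note dot = closest_point_dot[OF C(1) assms(1)]
  have "(x - ?p) \<bullet> (y - ?p) \<le> 0" if "y \<in> C" for y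
    using dot that .
  from this[of 0] this[of "2 *\<^sub>R ?p"] show orth: "(x - ?p) \<bullet> ?p = 0"
    using C(3) convex_cone_scaleR[OF assms(2) _ p, of 2] by (auto simp: inner_diff_right)
  show "(x - ?p) \<bullet> y \<le> 0" if "y \<in> C" for y
    using dot[OF that, of x] orth by (simp add: inner_diff_right)
qed

text \<open>A converse to the preceding facts: the conditions make the cross term in the expansion
  of the squared distance nonnegative, so no point of \<open>C\<close> is closer than
  \<open>p\<close>.\<close>

lemma cone_closest_point_unique:
  fixes C :: "'a::euclidean_space set"
  assumes "closed C" "convex C"
    and p: "p \<in> C" "(x - p) \<bullet> p = 0" "\<And>y. y \<in> C \<Longrightarrow> (x - p) \<bullet> y \<le> 0"
  shows "closest_point C x = p"
proof (rule closest_point_unique[symmetric, OF assms(2,1) p(1)], rule ballI)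
  fix y assume "y \<in> C"
  have "(norm (x - y))\<^sup>2 = (norm (x - p))\<^sup>2 + (norm (p - y))\<^sup>2 + 2 * ((x - p) \<bullet> (p - y))"
    by (simp add: power2_norm_eq_inner algebra_simps inner_commute)
  moreover have "(x - p) \<bullet> (p - y) \<ge> 0"
    using p(2) p(3)[OF \<open>y \<in> C\<close>] by (simp add: inner_diff_right)
  ultimately have "(norm (x - p))\<^sup>2 \<le> (norm (x - y))\<^sup>2"
    by simp
  then show "dist x p \<le> dist x y"
    unfolding dist_norm by (rule power2_le_imp_le) simp
qed

lemma cone_norm_Pythagoras:
  fixes C :: "'a::euclidean_space set"
  assumes "closed C" "convex_cone C"
  shows "(norm x)\<^sup>2 = (norm (closest_point C x))\<^sup>2 + (norm (x - closest_point C x))\<^sup>2"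
proof -
  have "(norm x)\<^sup>2 = (norm (closest_point C x))\<^sup>2 + (norm (x - closest_point C x))\<^sup>2 +
      2 * ((x - closest_point C x) \<bullet> closest_point C x)"
    by (simp add: power2_norm_eq_inner algebra_simps inner_commute)
  then show ?thesis
    by (simp add: cone_closest_point_orthogonal[OF assms])
qed

section \<open>Polar cones and projection lengths\<close>

lemma closed_polar_cone: "closed (polar_cone C)"
proof -
  have "polar_cone C = (\<Inter>x\<in>C. {u. x \<bullet> u \<le> 0})"
    by (auto simp: polar_cone_def inner_commute)
  then show ?thesis
    by (auto intro!: closed_halfspace_le)
qed

lemma convex_cone_polar_cone: "convex_cone (polar_cone C)"
proof -
  have "polar_cone C = (\<Inter>x\<in>C. {u. x \<bullet> u \<le> 0})"
    by (auto simp: polar_cone_def inner_commute)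
  then show ?thesis
    by (auto intro!: convex_cone_Inter convex_cone_halfspace_le)
qed

text \<open>Moreau's decomposition: the residual satisfies the three conditions of
  \<open>cone_closest_point_unique\<close> for the polar cone.\<close>

lemma closest_point_polar_cone:
  fixes C :: "'a::euclidean_space set"
  assumes "closed C" "convex_cone C"
  shows "closest_point (polar_cone C) x = x - closest_point C x"
proof (rule cone_closest_point_unique[OF closed_polar_cone])
  show "convex (polar_cone C)"
    using convex_cone_polar_cone[of C] by (simp add: convex_cone_def)
  show "x - closest_point C x \<in> polar_cone C"
    using cone_closest_point_dot_le[OF assms] by (auto simp: polar_cone_def)
  show "(x - (x - closest_point C x)) \<bullet> (x - closest_point C x) = 0"
    using cone_closest_point_orthogonal[OF assms, of x] by (simp add: inner_commute)
  show "(x - (x - closest_point C x)) \<bullet> y \<le> 0" if "y \<in> polar_cone C" for y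
    using that cone_closest_point_in[OF assms, of x] by (auto simp: polar_cone_def inner_commute)
qed

text \<open>Together with the next lemma this describes a nonzero projection length as a maximum of
  inner products with unit vectors of \<open>C\<close>, a form that depends only on the spherical
  section measured by the conic Hausdorff distance.\<close>

lemma cone_inner_le_norm_closest_point:
  fixes C :: "'a::euclidean_space set"
  assumes "closed C" "convex_cone C" "u \<in> C" "norm u = 1"
  shows "u \<bullet> x \<le> norm (closest_point C x)"
proof -
  have "u \<bullet> x = u \<bullet> closest_point C x + (x - closest_point C x) \<bullet> u"
    by (simp add: inner_diff_left inner_commute[of u])
  also have "\<dots> \<le> norm u * norm (closest_point C x) + 0"
    by (intro add_mono norm_cauchy_schwarz cone_closest_point_dot_le assms)
  finally show ?thesis using assms by simp
qed

lemma cone_inner_eq_norm_closest_point: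
  fixes C :: "'a::euclidean_space set"
  assumes "closed C" "convex_cone C" "closest_point C x \<noteq> 0"
  obtains u where "u \<in> C" "norm u = 1" "u \<bullet> x = norm (closest_point C x)"
proof
  let ?p = "closest_point C x"
  let ?u = "(1 / norm ?p) *\<^sub>R ?p"
  show "?u \<in> C"
    using cone_closest_point_in[OF assms(1,2)] by (intro convex_cone_scaleR assms) auto
  show "norm ?u = 1" using assms(3) by simp
  have "?p \<bullet> x = ?p \<bullet> ?p"
    using cone_closest_point_orthogonal[OF assms(1,2), of x] by (simp add: inner_diff_left inner_commute[of ?p x])
  then show "?u \<bullet> x = norm ?p"
    using assms(3) by (simp add: power2_norm_eq_inner[symmetric] power2_eq_square)
qed

section \<open>Gaussian integrals attached to a cone\<close>

lemma borel_measurable_closest_point [measurable]: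
  fixes C :: "'a::euclidean_space set"
  assumes "closed C" "convex_cone C"
  shows "closest_point C \<in> borel_measurable borel"
  using assms by (intro borel_measurable_continuous_onI continuous_on_closest_point) (auto simp: convex_cone_def)

text \<open>The two Moreau components of \<open>x\<close> are measured in units of \<open>s\<close>
  and \<open>t\<close>. At \<open>s = t = 1\<close> Pythagoras turns this into the unnormalized
  standard Gaussian integral.\<close>

definition cone_gaussian :: "'a::euclidean_space set \<Rightarrow> real \<Rightarrow> real \<Rightarrow> ennreal" where
  "cone_gaussian C s t = (\<integral>\<^sup>+x. ennreal
     (exp (- ((norm (closest_point C x) / s)\<^sup>2 + (norm (x - closest_point C x) / t)\<^sup>2) / 2)) \<partial>lborel)"

lemma cone_gaussian_polar_cone:
  fixes C :: "'a::euclidean_space set"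
  assumes "closed C" "convex_cone C"
  shows "cone_gaussian (polar_cone C) s t = cone_gaussian C t s"
  by (simp add: cone_gaussian_def closest_point_polar_cone[OF assms] add.commute)

text \<open>Prekopa-Leindler with a Gaussian of variance 4 as the dominating function. The bound
  \<open>key\<close> rests on the nonpositive inner products between \<open>C\<close> and its polar
  and on Cauchy-Schwarz with the weights \<open>s\<close> and \<open>s'\<close>.\<close>

lemma cone_gaussian_mult_le:
  fixes C :: "'a::euclidean_space set"
  assumes C: "closed C" "convex_cone C" and s: "s > 0" "s' > 0" "s\<^sup>2 + s'\<^sup>2 = 2"
  shows "cone_gaussian C s 1 * cone_gaussian C s' 1 \<le> ennreal ((2 * pi) ^ DIM('a))"
proof -
  let ?P = "closest_point C"
  let ?h = "\<lambda>s x. ennreal (exp (- ((norm (?P x) / s)\<^sup>2 + (norm (x - ?P x) / 1)\<^sup>2) / 2))"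
  \<comment> \<open>The square of this function is \<open>exp (- (norm x)\<^sup>2 / 4)\<close>,
    which matches \<open>key\<close>. The square of its integral is
    \<open>4 ^ DIM('a) * (2 * pi) ^ DIM('a)\<close>, so the power of 4 from Prekopa-Leindler
    cancels.\<close>
  let ?g = "\<lambda>x :: 'a. ennreal (exp (- ((1 / 4) / 2) * (norm x)\<^sup>2))"
  note [measurable] = borel_measurable_closest_point[OF C]
  have key: "(norm (x + y))\<^sup>2 \<le> 2 * ((norm (?P x) / s)\<^sup>2 + (norm (x - ?P x))\<^sup>2 +
      ((norm (?P y) / s')\<^sup>2 + (norm (y - ?P y))\<^sup>2))" for x y
  proof -
    define p q p' q' where "p = ?P x" "q = x - ?P x" "p' = ?P y" "q' = y - ?P y"
    note d = this
    have "q \<bullet> p = 0" "q' \<bullet> p' = 0" "q \<bullet> p' \<le> 0" "q' \<bullet> p \<le> 0"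
      unfolding d using cone_closest_point[OF C] by auto
    moreover have "(norm (x + y))\<^sup>2 = (norm (p + p'))\<^sup>2 + (norm (q + q'))\<^sup>2 +
        2 * (q \<bullet> p + q' \<bullet> p' + q \<bullet> p' + q' \<bullet> p)"
      by (simp add: d power2_norm_eq_inner algebra_simps inner_commute)
    ultimately have 1: "(norm (x + y))\<^sup>2 \<le> (norm (p + p'))\<^sup>2 + (norm (q + q'))\<^sup>2"
      by simp
    have "(norm (p + p'))\<^sup>2 \<le> (norm p + norm p')\<^sup>2"
      by (intro power_mono norm_triangle_ineq) auto
    also have "\<dots> \<le> 2 * ((norm p / s)\<^sup>2 + (norm p' / s')\<^sup>2)"
    proof -
      define A B where "A = norm p / s" "B = norm p' / s'"
      then have AB: "norm p = s * A" "norm p' = s' * B" using s by auto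
      \<comment> \<open>Lagrange's identity in the plane; this is where the constraint
        \<open>s\<^sup>2 + s'\<^sup>2 = 2\<close> enters.\<close>
      have "2 * (A\<^sup>2 + B\<^sup>2) - (s * A + s' * B)\<^sup>2 = (s\<^sup>2 + s'\<^sup>2) * (A\<^sup>2 + B\<^sup>2) - (s * A + s' * B)\<^sup>2"
        using s by simp
      also have "\<dots> = (s' * A - s * B)\<^sup>2" by algebra
      finally show ?thesis
        using zero_le_power2[of "s' * A - s * B"] unfolding A_B_def[symmetric] unfolding AB by linarith
    qed
    finally have 2: "(norm (p + p'))\<^sup>2 \<le> 2 * ((norm p / s)\<^sup>2 + (norm p' / s')\<^sup>2)" .
    have "(norm (q + q'))\<^sup>2 \<le> (norm q + norm q')\<^sup>2"
      by (intro power_mono norm_triangle_ineq) auto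
    also have "\<dots> \<le> 2 * ((norm q)\<^sup>2 + (norm q')\<^sup>2)"
      using zero_le_power2[of "norm q - norm q'"] by (simp add: power2_eq_square algebra_simps)
    finally show ?thesis
      using 1 2 unfolding d by simp
  qed
  have "4 ^ DIM('a) * (\<integral>\<^sup>+x. ?h s x \<partial>lborel) * (\<integral>\<^sup>+x. ?h s' x \<partial>lborel)
      \<le> (\<integral>\<^sup>+x. ?g x \<partial>lborel)\<^sup>2"
  proof (rule prekopa_leindler)
    fix x y
    have "- ((norm (?P x) / s)\<^sup>2 + (norm (x - ?P x) / 1)\<^sup>2) / 2 +
        - ((norm (?P y) / s')\<^sup>2 + (norm (y - ?P y) / 1)\<^sup>2) / 2
        \<le> - ((1 / 4) / 2) * (norm (x + y))\<^sup>2 + - ((1 / 4) / 2) * (norm (x + y))\<^sup>2"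
      using key[of x y] by (simp add: field_simps)
    then show "?h s x * ?h s' y \<le> (?g (x + y))\<^sup>2"
      by (simp add: power2_eq_square ennreal_mult[symmetric] exp_add[symmetric] del: ennreal_mult)
  qed measurable
  also have "(\<integral>\<^sup>+x. ?g x \<partial>lborel) = ennreal (sqrt (8 * pi) ^ DIM('a))"
    using nn_integral_exp_norm_square[of "1 / 4", where 'a='a] by simp
  also have "\<dots>\<^sup>2 = ennreal ((sqrt (8 * pi) ^ DIM('a))\<^sup>2)"
    by (rule ennreal_power) simp
  also have "(sqrt (8 * pi) ^ DIM('a))\<^sup>2 = 4 ^ DIM('a) * (2 * pi) ^ DIM('a)"
  proof -
    have "(sqrt (8 * pi) ^ DIM('a))\<^sup>2 = ((sqrt (8 * pi))\<^sup>2) ^ DIM('a)"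
      by (simp only: power_mult[symmetric] mult.commute)
    also have "\<dots> = (4 * (2 * pi)) ^ DIM('a)" by simp
    finally show ?thesis by (simp only: power_mult_distrib)
  qed
  also have "ennreal \<dots> = ennreal (4 ^ DIM('a)) * ennreal ((2 * pi) ^ DIM('a))"
    by (rule ennreal_mult) auto
  also have "ennreal (4 ^ DIM('a)) = 4 ^ DIM('a)"
    by (simp add: ennreal_power[symmetric])
  finally have *: "4 ^ DIM('a) * (cone_gaussian C s 1 * cone_gaussian C s' 1) \<le> 4 ^ DIM('a) * ennreal ((2 * pi) ^ DIM('a))"
    by (simp add: cone_gaussian_def mult.assoc)
  have "(4 :: ennreal) ^ DIM('a) = ennreal (4 ^ DIM('a))"
    by (simp add: ennreal_power[symmetric])
  then show ?thesis
    using * by (simp add: ennreal_mult_le_mult_iff)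
qed

section \<open>The Steiner formula for polyhedral cones\<close>

lemma polyhedral_cone_closed_convex_cone:
  assumes "polyhedral_cone C"
  shows "closed C" "convex_cone C" "polyhedron C"
proof -
  obtain F where F: "finite F" "C = \<Inter> F" "\<And>h. h \<in> F \<Longrightarrow> \<exists>a. a \<noteq> 0 \<and> h = {x. a \<bullet> x \<le> 0}"
    using assms by (auto simp: polyhedral_cone_def)
  show "polyhedron C"
    unfolding polyhedron_def
  proof (intro exI[of _ F] conjI ballI)
    fix h assume "h \<in> F"
    from F(3)[OF this] show "\<exists>a b. a \<noteq> 0 \<and> h = {x. a \<bullet> x \<le> b}" by (elim exE) blast
  qed (use F in auto)
  then show "closed C" by (rule polyhedron_imp_closed)
  show "convex_cone C"
    unfolding F(2)
  proof (rule convex_cone_Inter)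
    fix h assume "h \<in> F"
    then obtain a where "h = {x. a \<bullet> x \<le> 0}" using F(3) by blast
    then show "convex_cone h" using convex_cone_halfspace_le by auto
  qed
qed

text \<open>A face of least dimension containing \<open>x\<close> works: if \<open>x\<close> were on
  its relative frontier, it would lie in a proper face, which has smaller dimension.\<close>

lemma polyhedron_rel_interior_face:
  fixes S :: "'a::euclidean_space set"
  assumes S: "polyhedron S" and x: "x \<in> S"
  obtains F where "F face_of S" "x \<in> rel_interior F"
proof -
  define Q where "Q F \<longleftrightarrow> F face_of S \<and> x \<in> F" for F
  have "Q S"
    using S x by (auto simp: Q_def face_of_refl polyhedron_imp_convex)
  \<comment> \<open>Adding 1 before applying \<open>nat\<close> loses nothing, since affine
    dimensions start at -1.\<close>
  then obtain F where F: "Q F" and min: "\<And>G. Q G \<Longrightarrow> nat (aff_dim F + 1) \<le> nat (aff_dim G + 1)"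
    using ex_has_least_nat[of Q S "\<lambda>F. nat (aff_dim F + 1)"] by blast
  have "polyhedron F"
    using F S face_of_polyhedron_polyhedron by (auto simp: Q_def)
  have "x \<in> rel_interior F"
  proof (rule ccontr)
    assume "x \<notin> rel_interior F"
    then have "x \<in> rel_frontier F"
      using F closure_subset[of F] by (auto simp: rel_frontier_def Q_def)
    then obtain G where G: "G face_of F" "G \<noteq> F" "x \<in> G"
      using rel_frontier_of_polyhedron_alt[OF \<open>polyhedron F\<close>] by auto
    have "aff_dim G < aff_dim F"
      using G \<open>polyhedron F\<close> by (intro face_of_aff_dim_lt polyhedron_imp_convex)
    moreover have "Q G"
      using G F face_of_trans by (auto simp: Q_def)
    moreover have "aff_dim G \<ge> -1"
      by (rule aff_dim_geq)
    ultimately show False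
      using min[of G] by simp
  qed
  then show ?thesis
    using that F by (auto simp: Q_def)
qed

text \<open>A nonzero point of the face is interior to a segment from the origin to a larger
  multiple of itself. Both ends then belong to the face, and convexity yields the points
  between.\<close>

lemma face_of_convex_cone_scaleR:
  fixes C :: "'a::euclidean_space set"
  assumes C: "convex_cone C" and F: "F face_of C" and f: "f \<in> F" and c: "c \<ge> 0"
  shows "c *\<^sub>R f \<in> F"
proof (cases "f = 0")
  case False
  \<comment> \<open>The factor \<open>c + 2\<close> exceeds both 1 and \<open>c\<close>, so the
    segment has \<open>f\<close> in its interior and reaches beyond
    \<open>c *\<^sub>R f\<close>.\<close>
  let ?g = "(c + 2) *\<^sub>R f"
  have fC: "f \<in> C" using face_of_imp_subset[OF F] f by auto
  have "0 \<in> C" "?g \<in> C"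
    using C fC c by (auto intro: convex_cone_contains_0 convex_cone_scaleR)
  moreover have "f \<in> open_segment 0 ?g"
    using False c by (auto simp: in_segment intro!: exI[of _ "1 / (c + 2)"])
  ultimately have "0 \<in> F" "?g \<in> F"
    using F f by (auto simp: face_of_def)
  then have "(1 - c / (c + 2)) *\<^sub>R 0 + (c / (c + 2)) *\<^sub>R ?g \<in> F"
    using c by (intro convexD_alt face_of_imp_convex[OF F]) auto
  then show ?thesis using c by simp
qed (use f in auto)

text \<open>Nonempty faces contain the origin. This links the affine dimension in
  \<open>polyhedral_intrinsic_volume\<close> to the linear dimension in the substitution.\<close>

lemma face_of_convex_cone_aff_dim:
  fixes C :: "'a::euclidean_space set"
  assumes "convex_cone C" "F face_of C" "F \<noteq> {}"
  shows "aff_dim F = int (dim F)"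
proof -
  obtain f where "f \<in> F" using assms by auto
  then have "0 \<in> F"
    using face_of_convex_cone_scaleR[OF assms(1,2), of f 0] by simp
  then show ?thesis
    by (intro aff_dim_zero hull_inc)
qed

section \<open>Points projected to the relative interior of a face\<close>

definition face_region :: "'a::euclidean_space set \<Rightarrow> 'a set \<Rightarrow> 'a set" where
  "face_region C F = {g. closest_point C g \<in> rel_interior F}"

text \<open>From a relative interior point one can move slightly away from any \<open>f\<close> and
  stay in the face. The residual is nonpositive there and at \<open>f\<close>, and it annihilates
  the projection, so it vanishes on \<open>f\<close>.\<close>

lemma face_region_orthogonal:
  fixes C :: "'a::euclidean_space set"
  assumes C: "closed C" "convex_cone C" and F: "F face_of C" and g: "g \<in> face_region C F"
    and x: "x \<in> span F"
  shows "(g - closest_point C g) \<bullet> x = 0"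
proof -
  let ?p = "closest_point C g" and ?q = "g - closest_point C g"
  have "?q \<bullet> f = 0" if f: "f \<in> F" for f
  proof -
    have "?p \<in> rel_interior F" using g by (simp add: face_region_def)
    then obtain e where e: "e > 1" "(1 - e) *\<^sub>R f + e *\<^sub>R ?p \<in> F"
      using convex_rel_interior_iff[OF face_of_imp_convex[OF F], of ?p] f by auto
    have "?q \<bullet> ((1 - e) *\<^sub>R f + e *\<^sub>R ?p) \<le> 0"
      using e(2) face_of_imp_subset[OF F] by (intro cone_closest_point_dot_le C) auto
    then have "(1 - e) * (?q \<bullet> f) \<le> 0"
      by (simp add: inner_add_right cone_closest_point_orthogonal[OF C])
    then have "?q \<bullet> f \<ge> 0"
      using e(1) by (simp add: mult_le_0_iff)
    moreover have "?q \<bullet> f \<le> 0"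
      using f face_of_imp_subset[OF F] by (intro cone_closest_point_dot_le C) auto
    ultimately show ?thesis by simp
  qed
  then have "orthogonal ?q x"
    by (intro orthogonal_to_span[OF x]) (simp add: orthogonal_def)
  then show ?thesis by (simp add: orthogonal_def)
qed

text \<open>The conditions characterizing the projection survive independent positive scalings of
  the two components, and the relative interior of a face is invariant under positive
  scaling.\<close>

lemma face_region_scale:
  fixes C :: "'a::euclidean_space set"
  assumes C: "closed C" "convex_cone C" and F: "F face_of C" and g: "g \<in> face_region C F"
    and ab: "a > 0" "b > 0"
  defines "p \<equiv> closest_point C g"
  shows "closest_point C (a *\<^sub>R p + b *\<^sub>R (g - p)) = a *\<^sub>R p"
    and "a *\<^sub>R p + b *\<^sub>R (g - p) \<in> face_region C F"
proof -
  show *: "closest_point C (a *\<^sub>R p + b *\<^sub>R (g - p)) = a *\<^sub>R p"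
  proof (rule cone_closest_point_unique)
    show "closed C" "convex C" using C by (auto simp: convex_cone_def)
    show "a *\<^sub>R p \<in> C"
      using C ab by (auto simp: p_def intro!: convex_cone_scaleR cone_closest_point_in)
    show "(a *\<^sub>R p + b *\<^sub>R (g - p) - a *\<^sub>R p) \<bullet> a *\<^sub>R p = 0"
      using cone_closest_point_orthogonal[OF C, of g] by (simp add: p_def)
    show "(a *\<^sub>R p + b *\<^sub>R (g - p) - a *\<^sub>R p) \<bullet> y \<le> 0" if "y \<in> C" for y
      using cone_closest_point_dot_le[OF C that, of g] ab by (simp add: p_def mult_le_0_iff)
  qed
  have "(*\<^sub>R) a ` F = F"
  proof
    show "(*\<^sub>R) a ` F \<subseteq> F"
      using face_of_convex_cone_scaleR[OF C(2) F] ab by auto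
    show "F \<subseteq> (*\<^sub>R) a ` F"
    proof
      fix f assume "f \<in> F"
      then have "(1 / a) *\<^sub>R f \<in> F" using face_of_convex_cone_scaleR[OF C(2) F] ab by auto
      then show "f \<in> (*\<^sub>R) a ` F" using ab by (auto intro!: image_eqI[of _ _ "(1 / a) *\<^sub>R f"])
    qed
  qed
  then have "(*\<^sub>R) a ` rel_interior F = rel_interior F"
    using rel_interior_scaleR[of a F] ab by simp
  then show "a *\<^sub>R p + b *\<^sub>R (g - p) \<in> face_region C F"
    using g * by (auto simp: face_region_def p_def)
qed

lemma borel_rel_interior:
  fixes S :: "'a::euclidean_space set"
  shows "rel_interior S \<in> sets borel"
proof -
  obtain U where "open U" "rel_interior S = affine hull S \<inter> U"
    using openin_rel_interior[of S] by (auto simp: openin_open)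
  moreover have "closed (affine hull S)" by (rule closed_affine_hull)
  ultimately show ?thesis by (auto intro!: sets.Int)
qed

lemma face_region_borel:
  assumes "closed C" "convex_cone C"
  shows "face_region C F \<in> sets borel"
  using measurable_sets_borel[OF borel_measurable_closest_point[OF assms] borel_rel_interior[of F]]
  by (simp add: face_region_def vimage_def)

text \<open>The map scaling \<open>span F\<close> by \<open>s\<close> and its orthogonal complement
  by \<open>t\<close> acts on the region by scaling projection and residual. It preserves membership
  in the region both ways and turns the weighted integrand into the standard one.\<close>

lemma nn_integral_face_region:
  fixes C :: "'a::euclidean_space set"
  assumes C: "closed C" "convex_cone C" and F: "F face_of C" and st: "s > 0" "t > 0"
  shows "(\<integral>\<^sup>+x. indicator (face_region C F) x * ennreal
      (exp (- ((norm (closest_point C x) / s)\<^sup>2 + (norm (x - closest_point C x) / t)\<^sup>2) / 2)) \<partial>lborel)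
    = ennreal (s ^ dim F * t ^ (DIM('a) - dim F)) *
      (\<integral>\<^sup>+x. indicator (face_region C F) x * ennreal (exp (- (norm x)\<^sup>2 / 2)) \<partial>lborel)"
    (is "(\<integral>\<^sup>+x. ?f x \<partial>lborel) = _")
proof -
  note [measurable] = borel_measurable_closest_point[OF C] face_region_borel[OF C]
  obtain T where T: "linear T" "inj T" "\<And>p. p \<in> span F \<Longrightarrow> T p = s *\<^sub>R p"
    "\<And>p. (\<And>x. x \<in> span F \<Longrightarrow> p \<bullet> x = 0) \<Longrightarrow> T p = t *\<^sub>R p"
    "\<And>f :: 'a \<Rightarrow> ennreal. f \<in> borel_measurable borel \<Longrightarrow> (\<integral>\<^sup>+x. f x \<partial>lborel) =
       ennreal (s ^ dim (span F) * t ^ (DIM('a) - dim (span F))) * (\<integral>\<^sup>+x. f (T x) \<partial>lborel)"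
    using subspace_scaling_exists[OF subspace_span[of F] st] by blast
  have Tg: "T (a *\<^sub>R closest_point C g + b *\<^sub>R (g - closest_point C g)) =
      (s * a) *\<^sub>R closest_point C g + (t * b) *\<^sub>R (g - closest_point C g)"
    if "g \<in> face_region C F" for g a b
  proof -
    have "closest_point C g \<in> span F"
      using that rel_interior_subset[of F] by (auto simp: face_region_def intro: span_base)
    then have "T (closest_point C g) = s *\<^sub>R closest_point C g" by (rule T(3))
    moreover have "T (g - closest_point C g) = t *\<^sub>R (g - closest_point C g)"
      using face_region_orthogonal[OF C F that] by (rule T(4))
    ultimately show ?thesis
      by (simp add: linear_add[OF T(1)] linear_scale[OF T(1)] mult.commute)
  qed
  have "?f (T x) = indicator (face_region C F) x * ennreal (exp (- (norm x)\<^sup>2 / 2))" for x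
  proof (cases "x \<in> face_region C F")
    case True
    have Tx: "T x = s *\<^sub>R closest_point C x + t *\<^sub>R (x - closest_point C x)"
      using Tg[OF True, of 1 1] by simp
    have P: "closest_point C (T x) = s *\<^sub>R closest_point C x"
      unfolding Tx by (rule face_region_scale(1)[OF C F True st])
    have "T x - closest_point C (T x) = t *\<^sub>R (x - closest_point C x)"
      unfolding P by (subst Tx) simp
    moreover have "T x \<in> face_region C F"
      unfolding Tx by (rule face_region_scale(2)[OF C F True st])
    ultimately show ?thesis
      using True st cone_norm_Pythagoras[OF C, of x] P by simp
  next
    case False
    have "T x \<notin> face_region C F"
    proof
      \<comment> \<open>Undoing the scaling gives a point of the region with the same image under
        \<open>T\<close> as \<open>x\<close>; injectivity identifies it with
        \<open>x\<close>.\<close>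
      let ?p = "closest_point C (T x)"
      let ?y = "(1 / s) *\<^sub>R ?p + (1 / t) *\<^sub>R (T x - ?p)"
      assume *: "T x \<in> face_region C F"
      have "T ?y = T x" using Tg[OF *, of "1 / s" "1 / t"] st by simp
      then have "?y = x" using T(2) by (simp add: inj_eq)
      then show False
        using face_region_scale(2)[OF C F *, of "1 / s" "1 / t"] st False by simp
    qed
    then show ?thesis using False by simp
  qed
  moreover have "?f \<in> borel_measurable borel" by measurable
  ultimately show ?thesis
    using T(5)[of ?f] by simp
qed

section \<open>Summation over the faces\<close>

lemma emeasure_std_gaussian:
  fixes A :: "'a::euclidean_space set"
  assumes [measurable]: "A \<in> sets borel"
  shows "(\<integral>\<^sup>+x. indicator A x * ennreal (exp (- (norm x)\<^sup>2 / 2)) \<partial>lborel) =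
    ennreal (sqrt (2 * pi) ^ DIM('a)) * emeasure std_gaussian A"
proof -
  have "emeasure std_gaussian A =
      (\<integral>\<^sup>+x. ennreal (exp (- (norm x)\<^sup>2 / 2) / sqrt (2 * pi) ^ DIM('a)) * indicator A x \<partial>lborel)"
    unfolding std_gaussian_def std_gaussian_density by (rule emeasure_density) auto
  moreover have "ennreal (exp (- (norm x)\<^sup>2 / 2)) = ennreal (sqrt (2 * pi) ^ DIM('a)) *
      ennreal (exp (- (norm x)\<^sup>2 / 2) / sqrt (2 * pi) ^ DIM('a))" for x :: 'a
    by (subst ennreal_mult[symmetric]) auto
  ultimately show ?thesis
    by (simp add: nn_integral_cmult[symmetric] mult_ac)
qed

lemma prob_space_std_gaussian: "prob_space (std_gaussian :: 'a::euclidean_space measure)"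
proof
  have "ennreal (sqrt (2 * pi) ^ DIM('a)) * emeasure std_gaussian (UNIV :: 'a set) =
      ennreal (sqrt (2 * pi) ^ DIM('a)) * 1"
    using emeasure_std_gaussian[of "UNIV :: 'a set"] nn_integral_exp_norm_square[of 1, where 'a='a]
    by simp
  then have "emeasure std_gaussian (UNIV :: 'a set) = 1"
    unfolding ennreal_mult_cancel_left by simp
  then show "emeasure std_gaussian (space (std_gaussian :: 'a measure)) = 1"
    by (simp add: std_gaussian_def)
qed

text \<open>The regions of the nonempty faces partition the space. Each contributes its Gaussian
  measure times a monomial that depends only on the dimension of the face, and the contributions are
  grouped by dimension.\<close>

theorem cone_gaussian_polyhedral:
  fixes C :: "'a::euclidean_space set"
  assumes "polyhedral_cone C" and st: "s > 0" "t > 0"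
  shows "cone_gaussian C s t = ennreal (sqrt (2 * pi) ^ DIM('a) *
    (\<Sum>k=0..DIM('a). polyhedral_intrinsic_volume k C * (s ^ k * t ^ (DIM('a) - k))))"
proof -
  note C = polyhedral_cone_closed_convex_cone[OF assms(1)]
  note [measurable] = borel_measurable_closest_point[OF C(1,2)] face_region_borel[OF C(1,2)]
  interpret prob_space "std_gaussian :: 'a measure" by (rule prob_space_std_gaussian)
  let ?R = "face_region C" and ?G = "std_gaussian :: 'a measure"
  let ?c = "sqrt (2 * pi) ^ DIM('a)"
  define Fs where "Fs = {F. F face_of C \<and> F \<noteq> {}}"
  have fin: "finite Fs"
    using finite_polyhedron_faces[OF C(3)] by (rule rev_finite_subset) (auto simp: Fs_def)
  have disj: "disjoint_family_on ?R Fs"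
    using face_of_eq by (fastforce simp: disjoint_family_on_def Fs_def face_region_def)
  have cover: "\<exists>F\<in>Fs. x \<in> ?R F" for x
    using polyhedron_rel_interior_face[OF C(3) cone_closest_point_in[OF C(1,2), of x]]
    by (metis (mono_tags, lifting) Fs_def empty_iff face_region_def mem_Collect_eq rel_interior_empty)
  have sets: "?R F \<in> sets ?G" for F
    by (simp add: std_gaussian_def)
  have vol: "polyhedral_intrinsic_volume k C = (\<Sum>F\<in>{F \<in> Fs. dim F = k}. measure ?G (?R F))" for k
  proof -
    have "{g. \<exists>F. F face_of C \<and> aff_dim F = int k \<and> closest_point C g \<in> rel_interior F} =
        (\<Union>F\<in>{F \<in> Fs. dim F = k}. ?R F)"
      using face_of_convex_cone_aff_dim[OF C(2)] rel_interior_subset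
      by (auto simp: Fs_def face_region_def) (metis aff_dim_empty_eq int_eq_iff_numeral negative_eq_positive of_nat_eq_iff rel_interior_empty empty_iff)+
    then show ?thesis
      unfolding polyhedral_intrinsic_volume_def
      using fin disj sets
      by (simp, intro finite_measure_finite_Union) (auto intro: disjoint_family_on_mono[of _ Fs])
  qed
  let ?e = "\<lambda>x. ennreal (exp (- ((norm (closest_point C x) / s)\<^sup>2 + (norm (x - closest_point C x) / t)\<^sup>2) / 2))"
  have one: "(\<Sum>F\<in>Fs. indicator (?R F) x) = (1 :: ennreal)" for x
  proof -
    obtain F where F: "F \<in> Fs" "x \<in> ?R F" using cover by blast
    then have "(\<Sum>F\<in>Fs. indicator (?R F) x) = (\<Sum>F'\<in>Fs. if F' = F then 1 else (0 :: ennreal))"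
      using disj by (intro sum.cong) (auto simp: disjoint_family_on_def indicator_def)
    then show ?thesis using F fin by simp
  qed
  have "cone_gaussian C s t = (\<integral>\<^sup>+x. (\<Sum>F\<in>Fs. indicator (?R F) x) * ?e x \<partial>lborel)"
    unfolding cone_gaussian_def one by simp
  also have "\<dots> = (\<integral>\<^sup>+x. (\<Sum>F\<in>Fs. indicator (?R F) x * ?e x) \<partial>lborel)"
    by (simp add: sum_distrib_right)
  also have "\<dots> = (\<Sum>F\<in>Fs. \<integral>\<^sup>+x. indicator (?R F) x * ?e x \<partial>lborel)"
    by (rule nn_integral_sum) measurable
  also have "\<dots> = (\<Sum>F\<in>Fs. ennreal (?c * (measure ?G (?R F) * (s ^ dim F * t ^ (DIM('a) - dim F)))))"
  proof (rule sum.cong)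
    fix F assume "F \<in> Fs"
    then have F: "F face_of C" by (simp add: Fs_def)
    have "(\<integral>\<^sup>+x. indicator (?R F) x * ?e x \<partial>lborel) =
        ennreal (s ^ dim F * t ^ (DIM('a) - dim F)) * (ennreal ?c * ennreal (measure ?G (?R F)))"
      unfolding nn_integral_face_region[OF C(1,2) F st]
      by (simp only: emeasure_std_gaussian[OF face_region_borel[OF C(1,2)]] emeasure_eq_measure)
    then show "(\<integral>\<^sup>+x. indicator (?R F) x * ?e x \<partial>lborel) =
        ennreal (?c * (measure ?G (?R F) * (s ^ dim F * t ^ (DIM('a) - dim F))))"
      using st by (simp add: ennreal_mult[symmetric] mult_ac)
  qed simp
  also have "\<dots> = ennreal (\<Sum>F\<in>Fs. ?c * (measure ?G (?R F) * (s ^ dim F * t ^ (DIM('a) - dim F))))"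
    using st by (intro sum_ennreal) auto
  also have "(\<Sum>F\<in>Fs. ?c * (measure ?G (?R F) * (s ^ dim F * t ^ (DIM('a) - dim F)))) =
      ?c * (\<Sum>F\<in>Fs. measure ?G (?R F) * (s ^ dim F * t ^ (DIM('a) - dim F)))"
    by (simp add: sum_distrib_left)
  also have "(\<Sum>F\<in>Fs. measure ?G (?R F) * (s ^ dim F * t ^ (DIM('a) - dim F))) =
      (\<Sum>k=0..DIM('a). \<Sum>F\<in>{F \<in> Fs. dim F = k}. measure ?G (?R F) * (s ^ dim F * t ^ (DIM('a) - dim F)))"
    using fin by (intro sum.group[symmetric]) (auto simp: dim_subset_UNIV)
  also have "\<dots> = (\<Sum>k=0..DIM('a). polyhedral_intrinsic_volume k C * (s ^ k * t ^ (DIM('a) - k)))"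
    unfolding vol sum_distrib_right by (intro sum.cong) auto
  finally show ?thesis .
qed

section \<open>Passage to general cones\<close>

lemma one_sided_hausdorff_closest_point:
  fixes C P :: "'a::euclidean_space set"
  assumes C: "closed C" "convex_cone C" and P: "closed P" "convex_cone P"
    and e: "(SUP u\<in>C \<inter> sphere 0 1. INF v\<in>P \<inter> sphere 0 1. ennreal (dist u v)) < ennreal e"
  shows "norm (closest_point C x) \<le> norm (closest_point P x) + e * norm x"
proof (cases "closest_point C x = 0")
  case True
  have "e > 0" using e by (simp add: order_le_less_trans[OF zero_le] flip: ennreal_less_zero_iff)
  then show ?thesis using True by simp
next
  case False
  \<comment> \<open>A unit vector attaining the projection length on \<open>C\<close> is replaced by
    a unit vector of \<open>P\<close> within distance \<open>e\<close>, which costs at most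
    \<open>e * norm x\<close>.\<close>
  then obtain u where u: "u \<in> C" "norm u = 1" "u \<bullet> x = norm (closest_point C x)"
    using cone_inner_eq_norm_closest_point[OF C] by blast
  then have "(INF v\<in>P \<inter> sphere 0 1. ennreal (dist u v)) < ennreal e"
    using e by (intro le_less_trans[OF SUP_upper e]) auto
  then obtain v where v: "v \<in> P" "norm v = 1" "ennreal (dist u v) < ennreal e"
    by (auto simp: INF_less_iff)
  then have "norm (u - v) \<le> e"
    by (simp add: ennreal_less_iff dist_norm)
  have "u \<bullet> x = v \<bullet> x + (u - v) \<bullet> x" by (simp add: inner_diff_left)
  also have "\<dots> \<le> norm (closest_point P x) + norm (u - v) * norm x"
    using v by (intro add_mono cone_inner_le_norm_closest_point P norm_cauchy_schwarz)
  also have "\<dots> \<le> norm (closest_point P x) + e * norm x"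
    using \<open>norm (u - v) \<le> e\<close> by (simp add: mult_right_mono)
  finally show ?thesis using u by simp
qed

text \<open>Norms suffice for the integrals, because Pythagoras determines the length of the
  residual from that of the projection.\<close>

lemma norm_closest_point_tendsto:
  fixes C :: "'a::euclidean_space set" and P :: "nat \<Rightarrow> 'a set"
  assumes C: "closed C" "convex_cone C" and P: "\<And>i. closed (P i)" "\<And>i. convex_cone (P i)"
    and lim: "(\<lambda>i. conic_hausdorff_dist (P i) C) \<longlonglongrightarrow> 0"
  shows "(\<lambda>i. norm (closest_point (P i) x)) \<longlonglongrightarrow> norm (closest_point C x)"
proof (rule LIMSEQ_I)
  fix r :: real assume "r > 0"
  define e where "e = r / (norm x + 1)"
  have e: "e > 0" "e * norm x < r"
  proof -
    have "norm x + 1 > 0" by (intro add_nonneg_pos) auto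
    then show "e > 0" "e * norm x < r"
      using \<open>r > 0\<close> by (simp_all add: e_def divide_less_eq algebra_simps)
  qed
  have "eventually (\<lambda>i. conic_hausdorff_dist (P i) C < ennreal e) sequentially"
    using order_tendstoD(2)[OF lim] e by simp
  then obtain N where N: "\<And>i. i \<ge> N \<Longrightarrow> conic_hausdorff_dist (P i) C < ennreal e"
    by (auto simp: eventually_sequentially)
  have "norm (norm (closest_point (P i) x) - norm (closest_point C x)) < r" if "i \<ge> N" for i
  proof -
    have "(SUP u\<in>P i \<inter> sphere 0 1. INF v\<in>C \<inter> sphere 0 1. ennreal (dist u v)) < ennreal e"
      "(SUP v\<in>C \<inter> sphere 0 1. INF u\<in>P i \<inter> sphere 0 1. ennreal (dist v u)) < ennreal e"
      using N[OF that] by (simp_all add: conic_hausdorff_dist_def hausdorff_dist_def dist_commute)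
    then have "norm (closest_point C x) \<le> norm (closest_point (P i) x) + e * norm x"
      "norm (closest_point (P i) x) \<le> norm (closest_point C x) + e * norm x"
      using C P by (auto intro!: one_sided_hausdorff_closest_point)
    then show ?thesis using e by simp
  qed
  then show "\<exists>N. \<forall>i\<ge>N. norm (norm (closest_point (P i) x) - norm (closest_point C x)) < r"
    by blast
qed

section \<open>Approximation by polyhedral cones\<close>

lemma polyhedral_cone_iff: "polyhedral_cone C \<longleftrightarrow> polyhedron C \<and> convex_cone C"
proof
  assume "polyhedron C \<and> convex_cone C"
  then have C: "polyhedron C" "convex_cone C" by auto
  obtain F where F: "finite F" "C = \<Inter> F" "\<forall>h\<in>F. \<exists>a b. a \<noteq> 0 \<and> h = {x. a \<bullet> x \<le> b}"
    using C(1) by (auto simp: polyhedron_def)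
  then obtain a b where ab: "\<And>h. h \<in> F \<Longrightarrow> a h \<noteq> 0" "\<And>h. h \<in> F \<Longrightarrow> h = {x. a h \<bullet> x \<le> b h}"
    by metis
  have b: "b h \<ge> 0" if "h \<in> F" for h
  proof -
    have "0 \<in> h" using convex_cone_contains_0[OF C(2)] F(2) that by auto
    then show ?thesis using ab(2)[OF that] by (metis inner_zero_right mem_Collect_eq)
  qed
  \<comment> \<open>A positive inner product could be scaled past the bound \<open>b h\<close>, so
    each bounding halfspace can be moved to the origin without cutting into
    \<open>C\<close>.\<close>
  have hom: "a h \<bullet> x \<le> 0" if "x \<in> C" "h \<in> F" for x h
  proof (rule ccontr)
    assume "\<not> a h \<bullet> x \<le> 0"
    then have pos: "a h \<bullet> x > 0" by simp
    let ?c = "(b h + 1) / (a h \<bullet> x)"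
    have "?c *\<^sub>R x \<in> C"
      using b[OF that(2)] pos by (intro convex_cone_scaleR C that) auto
    then have "a h \<bullet> (?c *\<^sub>R x) \<le> b h"
      using F(2) that(2) ab(2)[OF that(2)] by (metis (no_types, lifting) InterE mem_Collect_eq)
    then show False using pos by simp
  qed
  have "C = \<Inter> ((\<lambda>h. {x. a h \<bullet> x \<le> 0}) ` F)"
  proof
    show "C \<subseteq> \<Inter> ((\<lambda>h. {x. a h \<bullet> x \<le> 0}) ` F)" using hom by auto
    show "\<Inter> ((\<lambda>h. {x. a h \<bullet> x \<le> 0}) ` F) \<subseteq> C"
    proof
      fix x assume x: "x \<in> \<Inter> ((\<lambda>h. {x. a h \<bullet> x \<le> 0}) ` F)"
      have "x \<in> h" if "h \<in> F" for h
      proof -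
        have "a h \<bullet> x \<le> b h" using x that b[OF that] by fastforce
        then show ?thesis using ab(2)[OF that] by auto
      qed
      then show "x \<in> C" using F(2) by auto
    qed
  qed
  then show "polyhedral_cone C"
    unfolding polyhedral_cone_def using F(1) ab(1)
    by (intro exI[of _ "(\<lambda>h. {x. a h \<bullet> x \<le> 0}) ` F"]) blast
qed (auto intro: polyhedral_cone_closed_convex_cone)

text \<open>The cone generated by a finite net of the spherical section lies inside \<open>C\<close>
  and contains the net. For the trivial cone the net is empty and its convex cone hull is again
  trivial.\<close>

lemma polyhedral_cone_approximation:
  fixes C :: "'a::euclidean_space set"
  assumes C: "closed C" "convex_cone C" and "e > 0"
  obtains P where "polyhedral_cone P" "conic_hausdorff_dist P C \<le> ennreal e"
proof -
  let ?S = "C \<inter> sphere 0 1"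
  have "compact ?S" using C(1) by (intro closed_Int_compact) auto
  then obtain N where N: "finite N" "N \<subseteq> ?S" "?S \<subseteq> (\<Union>x\<in>N. ball x e)"
    using \<open>e > 0\<close> seq_compact_imp_totally_bounded[OF compact_imp_seq_compact] by metis
  let ?P = "convex_cone hull N"
  have P: "polyhedral_cone ?P"
    using polyhedron_convex_cone_hull[OF N(1)] convex_cone_convex_cone_hull
    by (simp add: polyhedral_cone_iff)
  have sub: "?P \<subseteq> C"
    using N(2) C(2) by (intro hull_minimal) auto
  have "(SUP x\<in>?P \<inter> sphere 0 1. INF y\<in>?S. ennreal (dist x y)) \<le> ennreal e"
    using sub by (auto intro!: SUP_least INF_lower2)
  moreover have "(SUP y\<in>?S. INF x\<in>?P \<inter> sphere 0 1. ennreal (dist x y)) \<le> ennreal e"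
  proof (rule SUP_least)
    fix y assume "y \<in> ?S"
    then obtain z where z: "z \<in> N" "dist z y < e" using N(3) by auto
    then have "z \<in> ?P \<inter> sphere 0 1" using N(2) hull_inc[of z N] by auto
    then show "(INF x\<in>?P \<inter> sphere 0 1. ennreal (dist x y)) \<le> ennreal e"
      using z by (intro INF_lower2) (auto intro: ennreal_leI)
  qed
  ultimately have "conic_hausdorff_dist ?P C \<le> ennreal e"
    by (simp add: conic_hausdorff_dist_def hausdorff_dist_def)
  then show ?thesis using that P by blast
qed

lemma polyhedral_cone_sequence:
  fixes C :: "'a::euclidean_space set"
  assumes C: "closed C" "convex_cone C"
  obtains P where "\<And>i. polyhedral_cone (P i)" "(\<lambda>i. conic_hausdorff_dist (P i) C) \<longlonglongrightarrow> 0"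
proof -
  have "\<exists>P. polyhedral_cone P \<and> conic_hausdorff_dist P C \<le> ennreal (inverse (real (Suc i)))" for i
    using polyhedral_cone_approximation[OF C, of "inverse (real (Suc i))"] by (metis inverse_positive_iff_positive of_nat_0_less_iff zero_less_Suc)
  then obtain P where P: "\<And>i. polyhedral_cone (P i)"
      "\<And>i. conic_hausdorff_dist (P i) C \<le> ennreal (inverse (real (Suc i)))"
    by metis
  have lim: "(\<lambda>i. ennreal (inverse (real (Suc i)))) \<longlonglongrightarrow> 0"
    using tendsto_ennrealI[OF LIMSEQ_inverse_real_of_nat] by (simp only: ennreal_0)
  have "(\<lambda>i. conic_hausdorff_dist (P i) C) \<longlonglongrightarrow> 0"
    by (rule tendsto_sandwich[OF _ _ tendsto_const lim]) (simp_all only: always_eventually P(2) zero_le simp_thms)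
  then show ?thesis using that P(1) by blast
qed

text \<open>Lagrange interpolation. The weights \<open>c\<close> depend only on the nodes, so
  convergence of values at finitely many points implies convergence of every coefficient.\<close>

lemma coefficients_from_values:
  fixes x :: "nat \<Rightarrow> real"
  assumes "inj_on x {0..n}"
  obtains c where "\<And>a k. k \<le> n \<Longrightarrow> a k = (\<Sum>j=0..n. c k j * (\<Sum>i=0..n. a i * x j ^ i))"
proof -
  \<comment> \<open>The Lagrange basis polynomials: \<open>l j\<close> is 1 at \<open>x j\<close>
    and 0 at the other nodes.\<close>
  define l where "l j = (\<Prod>i\<in>{0..n} - {j}. smult (1 / (x j - x i)) [:- x i, 1:])" for j
  have deg: "degree (l j) \<le> n" if "j \<in> {0..n}" for j
  proof -
    have "degree (l j) \<le> (\<Sum>i\<in>{0..n} - {j}. degree (smult (1 / (x j - x i)) [:- x i, 1:]))"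
      unfolding l_def by (rule degree_prod_sum_le[unfolded o_def]) simp
    also have "\<dots> \<le> (\<Sum>i\<in>{0..n} - {j}. 1)" by (intro sum_mono) auto
    finally show ?thesis using that by simp
  qed
  have val: "poly (l j) (x i) = (if i = j then 1 else 0)" if "i \<in> {0..n}" "j \<in> {0..n}" for i j
  proof (cases "i = j")
    case True
    have "poly (l j) (x j) = (\<Prod>i\<in>{0..n} - {j}. 1)"
      unfolding l_def poly_prod using assms that
      by (intro prod.cong) (auto simp: inj_on_def diff_divide_distrib[symmetric])
    then show ?thesis using True by simp
  next
    case False
    then show ?thesis
      unfolding l_def poly_prod using that by (auto intro!: bexI[of _ i])
  qed
  show ?thesis
  proof (rule that[of "\<lambda>k j. coeff (l j) k"])
    fix a :: "nat \<Rightarrow> real" and k assume k: "k \<le> n"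
    define p where "p = (\<Sum>i=0..n. monom (a i) i)"
    define q where "q = (\<Sum>j=0..n. smult (poly p (x j)) (l j))"
    have pv: "poly p y = (\<Sum>i=0..n. a i * y ^ i)" for y
      by (simp add: p_def poly_sum poly_monom)
    have "degree (monom (a i) i) \<le> n" if "i \<in> {0..n}" for i
      using degree_monom_le[of "a i" i] that by simp
    then have dp: "degree p \<le> n"
      unfolding p_def by (intro degree_sum_le) auto
    have "degree (smult (poly p (x j)) (l j)) \<le> n" if "j \<in> {0..n}" for j
      using degree_smult_le[of "poly p (x j)" "l j"] deg[OF that] by simp
    then have dq: "degree q \<le> n"
      unfolding q_def by (intro degree_sum_le) auto
    have "poly q (x i) = poly p (x i)" if "i \<in> {0..n}" for i
    proof -
      have "poly q (x i) = (\<Sum>j=0..n. if i = j then poly p (x j) else 0)"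
        unfolding q_def poly_sum using that by (intro sum.cong) (auto simp: val)
      then show ?thesis using that by simp
    qed
    then have "p = q"
      using dp dq assms by (intro poly_eqI_degree[of "x ` {0..n}"]) (auto simp: card_image)
    then have "coeff p k = coeff q k" by simp
    moreover have "coeff p k = a k"
      using k by (simp add: p_def coeff_sum coeff_monom)
    ultimately show "a k = (\<Sum>j=0..n. coeff (l j) k * (\<Sum>i=0..n. a i * x j ^ i))"
      by (simp add: q_def coeff_sum pv mult.commute)
  qed
qed

text \<open>The majorant does not depend on the cone, so it dominates the integrands of a whole
  sequence of cones at once.\<close>

lemma cone_gaussian_integrand_le:
  fixes C :: "'a::euclidean_space set"
  assumes C: "closed C" "convex_cone C" and st: "s > 0" "t > 0"
  shows "exp (- ((norm (closest_point C x) / s)\<^sup>2 + (norm (x - closest_point C x) / t)\<^sup>2) / 2)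
    \<le> exp (- (min (1 / s\<^sup>2) (1 / t\<^sup>2) / 2) * (norm x)\<^sup>2)"
proof -
  let ?m = "min (1 / s\<^sup>2) (1 / t\<^sup>2)"
  have "?m * (norm x)\<^sup>2 = ?m * (norm (closest_point C x))\<^sup>2 + ?m * (norm (x - closest_point C x))\<^sup>2"
    unfolding cone_norm_Pythagoras[OF C, of x] by (rule distrib_left)
  also have "\<dots> \<le> 1 / s\<^sup>2 * (norm (closest_point C x))\<^sup>2 + 1 / t\<^sup>2 * (norm (x - closest_point C x))\<^sup>2"
    by (intro add_mono mult_right_mono) auto
  finally show ?thesis by (simp add: power_divide)
qed

lemma nn_integral_cone_gaussian_bound:
  assumes "s > 0" "t > 0"
  shows "(\<integral>\<^sup>+x. ennreal (exp (- (min (1 / s\<^sup>2) (1 / t\<^sup>2) / 2) * (norm x)\<^sup>2))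
    \<partial>(lborel :: 'a::euclidean_space measure)) < \<infinity>"
  using assms by (subst nn_integral_exp_norm_square) auto

lemma cone_gaussian_finite:
  fixes C :: "'a::euclidean_space set"
  assumes C: "closed C" "convex_cone C" and st: "s > 0" "t > 0"
  shows "cone_gaussian C s t < top"
  unfolding cone_gaussian_def
  by (rule le_less_trans[OF nn_integral_mono
        nn_integral_cone_gaussian_bound[OF st, where 'a='a, unfolded infinity_ennreal_def]])
     (intro ennreal_leI cone_gaussian_integrand_le C st)

lemma cone_gaussian_tendsto:
  fixes C :: "'a::euclidean_space set" and P :: "nat \<Rightarrow> 'a set"
  assumes C: "closed C" "convex_cone C" and P: "\<And>i. closed (P i)" "\<And>i. convex_cone (P i)"
    and lim: "(\<lambda>i. conic_hausdorff_dist (P i) C) \<longlonglongrightarrow> 0" and st: "s > 0" "t > 0"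
  shows "(\<lambda>i. cone_gaussian (P i) s t) \<longlonglongrightarrow> cone_gaussian C s t"
  unfolding cone_gaussian_def
proof (rule nn_integral_dominated_convergence)
  let ?w = "\<lambda>x :: 'a. ennreal (exp (- (min (1 / s\<^sup>2) (1 / t\<^sup>2) / 2) * (norm x)\<^sup>2))"
  note [measurable] = borel_measurable_closest_point[OF C]
  have [measurable]: "closest_point (P i) \<in> borel_measurable borel" for i
    by (rule borel_measurable_closest_point[OF P])
  show "(\<lambda>x. ennreal (exp (- ((norm (closest_point (P i) x) / s)\<^sup>2 +
      (norm (x - closest_point (P i) x) / t)\<^sup>2) / 2))) \<in> borel_measurable lborel" for i
    by measurable
  show "(\<lambda>x. ennreal (exp (- ((norm (closest_point C x) / s)\<^sup>2 +
      (norm (x - closest_point C x) / t)\<^sup>2) / 2))) \<in> borel_measurable lborel"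
    by measurable
  show "?w \<in> borel_measurable lborel" by measurable
  show "(\<integral>\<^sup>+x. ?w x \<partial>lborel) < \<infinity>"
    by (rule nn_integral_cone_gaussian_bound[OF st])
  show "AE x in lborel. ennreal (exp (- ((norm (closest_point (P i) x) / s)\<^sup>2 +
      (norm (x - closest_point (P i) x) / t)\<^sup>2) / 2)) \<le> ?w x" for i
    using cone_gaussian_integrand_le[OF P st] by (simp add: ennreal_leI)
  \<comment> \<open>This leaves projection lengths as the only quantities depending on the cone;
    their pointwise limits are known.\<close>
  have rewrite: "(norm (x - closest_point D x) / t)\<^sup>2 = ((norm x)\<^sup>2 - (norm (closest_point D x))\<^sup>2) / t\<^sup>2"
    if "closed D" "convex_cone D" for D :: "'a set" and x
    using cone_norm_Pythagoras[OF that, of x] by (simp add: power_divide)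
  show "AE x in lborel. (\<lambda>i. ennreal (exp (- ((norm (closest_point (P i) x) / s)\<^sup>2 +
      (norm (x - closest_point (P i) x) / t)\<^sup>2) / 2)))
    \<longlonglongrightarrow> ennreal (exp (- ((norm (closest_point C x) / s)\<^sup>2 + (norm (x - closest_point C x) / t)\<^sup>2) / 2))"
    unfolding rewrite[OF C] rewrite[OF P]
    using st by (intro AE_I2 tendsto_ennrealI tendsto_intros norm_closest_point_tendsto C P lim) auto
qed

section \<open>Normalized weights and limits of intrinsic volumes\<close>

definition gaussian_weight :: "'a::euclidean_space set \<Rightarrow> real \<Rightarrow> real \<Rightarrow> real" where
  "gaussian_weight C s t = enn2real (cone_gaussian C s t) / sqrt (2 * pi) ^ DIM('a)"

lemma gaussian_weight_polyhedral:
  fixes C :: "'a::euclidean_space set"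
  assumes "polyhedral_cone C" and st: "s > 0" "t > 0"
  shows "gaussian_weight C s t =
    (\<Sum>k=0..DIM('a). polyhedral_intrinsic_volume k C * (s ^ k * t ^ (DIM('a) - k)))"
proof -
  have "0 \<le> (\<Sum>k=0..DIM('a). polyhedral_intrinsic_volume k C * (s ^ k * t ^ (DIM('a) - k)))"
    using st by (intro sum_nonneg mult_nonneg_nonneg) (auto simp: polyhedral_intrinsic_volume_def)
  then show ?thesis
    unfolding gaussian_weight_def cone_gaussian_polyhedral[OF assms] by (simp add: enn2real_ennreal)
qed

lemma gaussian_weight_tendsto:
  fixes C :: "'a::euclidean_space set" and P :: "nat \<Rightarrow> 'a set"
  assumes C: "closed C" "convex_cone C" and P: "\<And>i. polyhedral_cone (P i)"
    and lim: "(\<lambda>i. conic_hausdorff_dist (P i) C) \<longlonglongrightarrow> 0" and st: "s > 0" "t > 0"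
  shows "(\<lambda>i. gaussian_weight (P i) s t) \<longlonglongrightarrow> gaussian_weight C s t"
  unfolding gaussian_weight_def
proof (intro tendsto_divide tendsto_const tendsto_enn2real)
  show "(\<lambda>i. cone_gaussian (P i) s t) \<longlonglongrightarrow> ennreal (enn2real (cone_gaussian C s t))"
    using cone_gaussian_tendsto[OF C polyhedral_cone_closed_convex_cone(1,2)[OF P] lim st]
      cone_gaussian_finite[OF C st] by simp
qed auto

text \<open>Interpolation at \<open>s = 1, ..., DIM('a) + 1\<close> with \<open>t = 1\<close> writes
  each intrinsic volume as a fixed linear combination of weights, which converge. The limit is a
  formula in \<open>C\<close>, hence common to all approximating sequences.\<close>

lemma polyhedral_intrinsic_volume_tendsto:
  fixes C :: "'a::euclidean_space set"
  assumes C: "closed C" "convex_cone C"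
  obtains v where "\<And>P k. (\<And>i. polyhedral_cone (P i)) \<Longrightarrow> (\<lambda>i. conic_hausdorff_dist (P i) C) \<longlonglongrightarrow> 0 \<Longrightarrow>
    k \<le> DIM('a) \<Longrightarrow> (\<lambda>i. polyhedral_intrinsic_volume k (P i)) \<longlonglongrightarrow> v k"
proof -
  let ?x = "\<lambda>j. real (Suc j)"
  obtain c where c: "\<And>a k. k \<le> DIM('a) \<Longrightarrow>
      a k = (\<Sum>j=0..DIM('a). c k j * (\<Sum>i=0..DIM('a). a i * ?x j ^ i))"
    using coefficients_from_values[of ?x "DIM('a)"] by (auto simp: inj_on_def)
  show ?thesis
  proof (rule that[of "\<lambda>k. \<Sum>j=0..DIM('a). c k j * gaussian_weight C (?x j) 1"])
    fix P :: "nat \<Rightarrow> 'a set" and k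
    assume P: "\<And>i. polyhedral_cone (P i)"
      and lim: "(\<lambda>i. conic_hausdorff_dist (P i) C) \<longlonglongrightarrow> 0" and k: "k \<le> DIM('a)"
    have "polyhedral_intrinsic_volume k (P i) =
        (\<Sum>j=0..DIM('a). c k j * gaussian_weight (P i) (?x j) 1)" for i
      by (subst c[OF k, of "\<lambda>k. polyhedral_intrinsic_volume k (P i)"])
         (simp add: gaussian_weight_polyhedral[OF P])
    then show "(\<lambda>i. polyhedral_intrinsic_volume k (P i)) \<longlonglongrightarrow>
        (\<Sum>j=0..DIM('a). c k j * gaussian_weight C (?x j) 1)"
      by (simp only:) (intro tendsto_intros gaussian_weight_tendsto C P lim; simp)
  qed
qed

text \<open>Justifies the definite description in \<open>intrinsic_volume\<close>: the common limit
  supplies existence, and the given approximating sequence supplies uniqueness.\<close>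

lemma intrinsic_volume_limit:
  fixes C :: "'a::euclidean_space set"
  assumes C: "closed C" "convex_cone C" and np: "\<not> polyhedral_cone C"
    and P: "\<And>i. polyhedral_cone (P i)" and lim: "(\<lambda>i. conic_hausdorff_dist (P i) C) \<longlonglongrightarrow> 0"
    and k: "k \<le> DIM('a)"
  shows "(\<lambda>i. polyhedral_intrinsic_volume k (P i)) \<longlonglongrightarrow> intrinsic_volume k C"
proof -
  obtain v where v: "\<And>P k. (\<And>i. polyhedral_cone (P i)) \<Longrightarrow> (\<lambda>i. conic_hausdorff_dist (P i) C) \<longlonglongrightarrow> 0 \<Longrightarrow>
      k \<le> DIM('a) \<Longrightarrow> (\<lambda>i. polyhedral_intrinsic_volume k (P i)) \<longlonglongrightarrow> v k"
    using polyhedral_intrinsic_volume_tendsto[OF C] by blast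
  have "intrinsic_volume k C = v k"
    unfolding intrinsic_volume_def using np
  proof (simp, intro the_equality allI impI)
    fix w assume "\<forall>P. (\<forall>i. polyhedral_cone (P i)) \<longrightarrow> (\<lambda>i. conic_hausdorff_dist (P i) C) \<longlonglongrightarrow> 0 \<longrightarrow>
      (\<lambda>i. polyhedral_intrinsic_volume k (P i)) \<longlonglongrightarrow> w"
    then have "(\<lambda>i. polyhedral_intrinsic_volume k (P i)) \<longlonglongrightarrow> w" using P lim by blast
    then show "w = v k" using v[OF P lim k] by (rule LIMSEQ_unique)
  qed (use v k in blast)
  then show ?thesis using v[OF P lim k] by simp
qed

text \<open>The polyhedral formula passes to the limit on both sides. At \<open>t = 1\<close> the
  weight is the generating function of the intrinsic volumes.\<close>

theorem gaussian_weight_intrinsic_volume: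
  fixes C :: "'a::euclidean_space set"
  assumes C: "closed C" "convex_cone C" and st: "s > 0" "t > 0"
  shows "gaussian_weight C s t = (\<Sum>k=0..DIM('a). intrinsic_volume k C * (s ^ k * t ^ (DIM('a) - k)))"
proof (cases "polyhedral_cone C")
  case True
  then show ?thesis using gaussian_weight_polyhedral[OF True st] by (simp add: intrinsic_volume_def)
next
  case False
  obtain P where P: "\<And>i. polyhedral_cone (P i)" "(\<lambda>i. conic_hausdorff_dist (P i) C) \<longlonglongrightarrow> 0"
    using polyhedral_cone_sequence[OF C] by blast
  have "(\<lambda>i. gaussian_weight (P i) s t) \<longlonglongrightarrow>
      (\<Sum>k=0..DIM('a). intrinsic_volume k C * (s ^ k * t ^ (DIM('a) - k)))"
    unfolding gaussian_weight_polyhedral[OF P(1) st]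
    by (intro tendsto_intros intrinsic_volume_limit[OF C False P]) auto
  then show ?thesis
    using gaussian_weight_tendsto[OF C P st] by (rule LIMSEQ_unique[rotated])
qed

lemma intrinsic_volume_nonneg:
  fixes C :: "'a::euclidean_space set"
  assumes C: "closed C" "convex_cone C" and k: "k \<le> DIM('a)"
  shows "0 \<le> intrinsic_volume k C"
proof (cases "polyhedral_cone C")
  case True
  then show ?thesis by (simp add: intrinsic_volume_def polyhedral_intrinsic_volume_def)
next
  case False
  obtain P where P: "\<And>i. polyhedral_cone (P i)" "(\<lambda>i. conic_hausdorff_dist (P i) C) \<longlonglongrightarrow> 0"
    using polyhedral_cone_sequence[OF C] by blast
  show ?thesis
    by (rule LIMSEQ_le_const[OF intrinsic_volume_limit[OF C False P k]])
       (auto simp: polyhedral_intrinsic_volume_def)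
qed

section \<open>Concentration\<close>

lemma gaussian_weight_polar_cone:
  fixes C :: "'a::euclidean_space set"
  assumes "closed C" "convex_cone C"
  shows "gaussian_weight (polar_cone C) s t = gaussian_weight C t s"
  by (simp add: gaussian_weight_def cone_gaussian_polar_cone[OF assms])

text \<open>Passing to the polar swaps the two arguments of the weight. At \<open>t = 1\<close> this
  reverses the coefficients of a polynomial in \<open>s\<close>, and interpolation identifies
  them.\<close>

lemma intrinsic_volume_polar_cone:
  fixes C :: "'a::euclidean_space set"
  assumes C: "closed C" "convex_cone C" and k: "k \<le> DIM('a)"
  shows "intrinsic_volume k (polar_cone C) = intrinsic_volume (DIM('a) - k) C"
proof -
  let ?x = "\<lambda>j. real (Suc j)"
  obtain c where c: "\<And>a k. k \<le> DIM('a) \<Longrightarrow>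
      a k = (\<Sum>j=0..DIM('a). c k j * (\<Sum>i=0..DIM('a). a i * ?x j ^ i))"
    using coefficients_from_values[of ?x "DIM('a)"] by (auto simp: inj_on_def)
  have "(\<Sum>i=0..DIM('a). intrinsic_volume i (polar_cone C) * s ^ i) =
      (\<Sum>i=0..DIM('a). intrinsic_volume (DIM('a) - i) C * s ^ i)" if "s > 0" for s :: real
  proof -
    have "(\<Sum>i=0..DIM('a). intrinsic_volume i (polar_cone C) * s ^ i) = gaussian_weight (polar_cone C) s 1"
      using that by (simp add: gaussian_weight_intrinsic_volume closed_polar_cone convex_cone_polar_cone)
    also have "\<dots> = (\<Sum>i=0..DIM('a). intrinsic_volume i C * s ^ (DIM('a) - i))"
      using that by (simp add: gaussian_weight_polar_cone[OF C] gaussian_weight_intrinsic_volume[OF C])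
    also have "\<dots> = (\<Sum>i=0..DIM('a). intrinsic_volume (DIM('a) - i) C * s ^ (DIM('a) - (DIM('a) - i)))"
      using sum.atLeastAtMost_rev[of "\<lambda>i. intrinsic_volume i C * s ^ (DIM('a) - i)" 0 "DIM('a)"] by simp
    also have "\<dots> = (\<Sum>i=0..DIM('a). intrinsic_volume (DIM('a) - i) C * s ^ i)"
      by (intro sum.cong) auto
    finally show ?thesis .
  qed
  then show ?thesis
    using c[OF k, of "\<lambda>i. intrinsic_volume i (polar_cone C)"]
      c[OF k, of "\<lambda>i. intrinsic_volume (DIM('a) - i) C"] by simp
qed

lemma sum_intrinsic_volume:
  fixes C :: "'a::euclidean_space set"
  assumes C: "closed C" "convex_cone C"
  shows "(\<Sum>k=0..DIM('a). intrinsic_volume k C) = 1"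
proof -
  have "cone_gaussian C 1 1 = (\<integral>\<^sup>+x. ennreal (exp (- (1 / 2) * (norm x)\<^sup>2)) \<partial>(lborel :: 'a measure))"
    unfolding cone_gaussian_def by (simp add: cone_norm_Pythagoras[OF C, symmetric])
  also have "\<dots> = ennreal (sqrt (2 * pi) ^ DIM('a))"
    by (subst nn_integral_exp_norm_square) auto
  finally have "gaussian_weight C 1 1 = 1"
    by (simp add: gaussian_weight_def)
  then show ?thesis
    by (simp add: gaussian_weight_intrinsic_volume[OF C])
qed

lemma gaussian_weight_mult_le:
  fixes C :: "'a::euclidean_space set"
  assumes C: "closed C" "convex_cone C" and s: "s > 0" "s' > 0" "s\<^sup>2 + s'\<^sup>2 = 2"
  shows "gaussian_weight C s 1 * gaussian_weight C s' 1 \<le> 1"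
proof -
  have "enn2real (cone_gaussian C s 1 * cone_gaussian C s' 1) \<le> (2 * pi) ^ DIM('a)"
    using enn2real_mono[OF cone_gaussian_mult_le[OF assms]] by simp
  moreover have "sqrt (2 * pi) ^ DIM('a) * sqrt (2 * pi) ^ DIM('a) = (2 * pi) ^ DIM('a)"
    by (simp only: power_mult_distrib[symmetric] real_sqrt_mult_self) simp
  ultimately show ?thesis
    by (simp add: gaussian_weight_def enn2real_mult)
qed

section \<open>Exponential tail bounds\<close>

lemma ln_tail_inequality:
  fixes r :: real
  assumes "0 \<le> r" "r \<le> 1 / 2"
  shows "r\<^sup>2 \<le> ln (1 + r) + (1 - 2 * r) * ln (1 - r)"
proof -
  \<comment> \<open>Both tails reduce to the nonnegativity of \<open>?f\<close>. It vanishes at 0,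
    and its derivative is nonnegative by \<open>ln (1 - x) \<le> - x\<close> and a cross-multiplied
    comparison of the two fractions.\<close>
  let ?f = "\<lambda>r :: real. ln (1 + r) + (1 - 2 * r) * ln (1 - r) - r\<^sup>2"
  have "?f 0 \<le> ?f r"
  proof (rule DERIV_nonneg_imp_nondecreasing[OF assms(1)])
    fix x assume x: "0 \<le> x" "x \<le> r"
    then have x': "0 \<le> x" "x \<le> 1 / 2" using assms by auto
    let ?d = "1 / (1 + x) - 2 * ln (1 - x) - (1 - 2 * x) / (1 - x) - 2 * x"
    have "(?f has_real_derivative ?d) (at x)"
      using x' by (auto intro!: derivative_eq_intros simp: diff_divide_distrib)
    moreover have "0 \<le> ?d"
    proof -
      have "ln (1 - x) \<le> - x" using ln_le_minus_one[of "1 - x"] x' by simp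
      moreover have "(1 - 2 * x) * (1 + x) \<le> 1 * (1 - x)"
        using zero_le_power2[of x] by (simp add: power2_eq_square algebra_simps)
      then have "(1 - 2 * x) / (1 - x) \<le> 1 / (1 + x)"
        using x' by (simp add: divide_simps)
      ultimately show ?thesis by linarith
    qed
    ultimately show "\<exists>y. (?f has_real_derivative y) (at x) \<and> 0 \<le> y" by blast
  qed
  then show ?thesis by simp
qed

text \<open>Collects the facts about intrinsic volumes from which the tail bounds follow, so that
  the same bounds serve a cone and its polar.\<close>

locale intrinsic_distribution =
  fixes v :: "nat \<Rightarrow> real" and n :: nat and \<delta> :: real
  assumes nonneg: "\<And>k. k \<le> n \<Longrightarrow> 0 \<le> v k"
    and total: "(\<Sum>k=0..n. v k) = 1"
    and mean: "\<delta> = (\<Sum>k=0..n. real k * v k)"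
    and mult_le: "\<And>s s'. 0 < s \<Longrightarrow> 0 < s' \<Longrightarrow> s\<^sup>2 + s'\<^sup>2 = 2 \<Longrightarrow>
      (\<Sum>k=0..n. v k * s ^ k) * (\<Sum>k=0..n. v k * s' ^ k) \<le> 1"
begin

lemma mean_nonneg: "0 \<le> \<delta>"
  unfolding mean by (intro sum_nonneg mult_nonneg_nonneg nonneg) auto

text \<open>The left side is \<open>s powr \<delta>\<close>. The tangent bound for
  \<open>exp\<close> is applied around the mean, where the linear term averages to zero.\<close>

lemma jensen:
  assumes "0 < s"
  shows "exp (\<delta> * ln s) \<le> (\<Sum>k=0..n. v k * s ^ k)"
proof -
  have "exp (\<delta> * ln s) = exp (\<delta> * ln s) * ((\<Sum>k=0..n. v k) + ln s * ((\<Sum>k=0..n. real k * v k) - \<delta> * (\<Sum>k=0..n. v k)))"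
    using total mean by simp
  also have "\<dots> = (\<Sum>k=0..n. v k * (exp (\<delta> * ln s) * (1 + (real k - \<delta>) * ln s)))"
    by (simp add: sum_distrib_left sum.distrib[symmetric] sum_subtractf[symmetric] algebra_simps)
  also have "\<dots> \<le> (\<Sum>k=0..n. v k * s ^ k)"
  proof (intro sum_mono mult_left_mono nonneg)
    fix k
    have "exp (\<delta> * ln s) * (1 + (real k - \<delta>) * ln s) \<le> exp (\<delta> * ln s) * exp ((real k - \<delta>) * ln s)"
      by (intro mult_left_mono exp_ge_add_one_self) simp
    also have "\<dots> = exp (real k * ln s)" by (simp add: exp_add[symmetric] algebra_simps)
    also have "\<dots> = s ^ k" using assms by (simp add: exp_of_nat_mult)
    finally show "exp (\<delta> * ln s) * (1 + (real k - \<delta>) * ln s) \<le> s ^ k" .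
  qed auto
  finally show ?thesis .
qed

lemma generating_function_le:
  assumes "0 < s" "0 < s'" "s\<^sup>2 + s'\<^sup>2 = 2"
  shows "(\<Sum>k=0..n. v k * s ^ k) \<le> exp (- \<delta> * ln s')"
proof -
  have "(\<Sum>k=0..n. v k * s ^ k) * exp (\<delta> * ln s') \<le> (\<Sum>k=0..n. v k * s ^ k) * (\<Sum>k=0..n. v k * s' ^ k)"
    using assms by (intro mult_left_mono jensen sum_nonneg mult_nonneg_nonneg nonneg) auto
  also have "\<dots> \<le> 1" by (rule mult_le[OF assms])
  finally show ?thesis by (simp add: exp_minus field_simps)
qed

text \<open>Stating the condition on \<open>A\<close> through \<open>ln s\<close> covers both tails:
  \<open>s > 1\<close> gives the upper one and \<open>s < 1\<close> the lower one.\<close>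

lemma markov:
  assumes "0 < s" "0 < s'" "s\<^sup>2 + s'\<^sup>2 = 2" "A \<subseteq> {0..n}"
    and A: "\<And>k. k \<in> A \<Longrightarrow> a * ln s \<le> real k * ln s"
  shows "(\<Sum>k\<in>A. v k) \<le> exp (- (a * ln s + \<delta> * ln s'))"
proof -
  have "(\<Sum>k\<in>A. v k) \<le> (\<Sum>k\<in>A. v k * (s ^ k * exp (- a * ln s)))"
  proof (rule sum_mono)
    fix k assume k: "k \<in> A"
    have "s ^ k = exp (real k * ln s)" using assms(1) by (simp add: exp_of_nat_mult)
    then have "s ^ k * exp (- a * ln s) = exp (real k * ln s - a * ln s)"
      by (simp add: exp_add[symmetric])
    then have "1 \<le> s ^ k * exp (- a * ln s)" using A[OF k] by simp
    then show "v k \<le> v k * (s ^ k * exp (- a * ln s))"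
      using nonneg[of k] k assms(4) by (auto simp: mult_le_cancel_left1)
  qed
  also have "\<dots> \<le> (\<Sum>k=0..n. v k * (s ^ k * exp (- a * ln s)))"
    using assms by (intro sum_mono2 mult_nonneg_nonneg nonneg) auto
  also have "\<dots> = (\<Sum>k=0..n. v k * s ^ k) * exp (- a * ln s)"
    by (simp add: sum_distrib_right mult.assoc)
  also have "\<dots> \<le> exp (- \<delta> * ln s') * exp (- a * ln s)"
    by (intro mult_right_mono generating_function_le assms) auto
  also have "\<dots> = exp (- (a * ln s + \<delta> * ln s'))"
    by (simp add: exp_add[symmetric])
  finally show ?thesis .
qed

lemma upper_tail:
  assumes "0 < x" "\<delta> + x \<le> real k"
  shows "(\<Sum>j=k..n. v j) \<le> exp (- x\<^sup>2 / 8 / (\<delta> + x))"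
proof -
  \<comment> \<open>not the optimal \<open>r = x / (2 * \<delta> + x)\<close>, but it reduces both tails to the same inequality
      and stays below \<open>1\<close> when \<open>\<delta> = 0\<close>\<close>
  define N r where "N = \<delta> + x" and "r = x / (2 * N)"
  have N: "N > 0" "x = 2 * r * N" "\<delta> = (1 - 2 * r) * N"
    using mean_nonneg assms(1) by (auto simp: N_def r_def field_simps)
  have r: "0 < r" "r \<le> 1 / 2"
    using mean_nonneg assms(1) by (auto simp: N_def r_def field_simps)
  \<comment> \<open>Markov's bound with threshold \<open>N\<close> and squared parameters
    \<open>1 + r\<close> and \<open>1 - r\<close>. Substituting
    \<open>\<delta> = (1 - 2 * r) * N\<close> makes the exponent a multiple of the expression in
    \<open>ln_tail_inequality\<close>.\<close>
  have "(\<Sum>j=k..n. v j) \<le> exp (- (N * ln (sqrt (1 + r)) + \<delta> * ln (sqrt (1 - r))))"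
    using r assms by (intro markov) (auto simp: N_def intro!: mult_right_mono)
  also have "\<dots> \<le> exp (- x\<^sup>2 / 8 / N)"
  proof -
    have "N * r\<^sup>2 \<le> N * (ln (1 + r) + (1 - 2 * r) * ln (1 - r))"
      using ln_tail_inequality[of r] r N(1) by (intro mult_left_mono) auto
    moreover have "x\<^sup>2 / 8 / N = N * r\<^sup>2 / 2"
      using N(1) by (simp add: N(2) power2_eq_square)
    moreover have "N * ln (sqrt (1 + r)) + \<delta> * ln (sqrt (1 - r)) =
        N * (ln (1 + r) + (1 - 2 * r) * ln (1 - r)) / 2"
      using r by (simp add: ln_sqrt N(3) algebra_simps)
    ultimately show ?thesis by simp
  qed
  finally show ?thesis by (simp add: N_def)
qed

lemma lower_tail:
  assumes "0 < x" "real k \<le> \<delta> - x + 1" "k \<le> n + 1"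
  shows "1 - (\<Sum>j=k..n. v j) \<le> exp (- x\<^sup>2 / 8 / (\<delta> + x))"
proof -
  have "1 - (\<Sum>j=k..n. v j) = (\<Sum>j\<in>{0..<k}. v j)"
  proof -
    have "{0..n} = {0..<k} \<union> {k..n}" using assms(3) by auto
    then have "(\<Sum>j=0..n. v j) = (\<Sum>j\<in>{0..<k} \<union> {k..n}. v j)"
      by (simp only:)
    also have "\<dots> = (\<Sum>j\<in>{0..<k}. v j) + (\<Sum>j=k..n. v j)"
      by (intro sum.union_disjoint) auto
    finally show ?thesis using total by simp
  qed
  also have "\<dots> \<le> exp (- x\<^sup>2 / 8 / (\<delta> + x))"
  proof (cases "x \<le> \<delta>")
    case False
    \<comment> \<open>Here \<open>\<delta> - x + 1 < 1\<close>, so the complementary sum is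
      empty.\<close>
    then have "k = 0" using assms(2) by linarith
    then show ?thesis by simp
  next
    case True
    \<comment> \<open>Now \<open>\<delta> - x = (1 - 2 * r) * \<delta>\<close>. With the roles of
      \<open>1 + r\<close> and \<open>1 - r\<close> exchanged, the exponent takes the same form as
      for the upper tail, with \<open>\<delta>\<close> in place of \<open>N\<close>.\<close>
    define r where "r = x / (2 * \<delta>)"
    have d: "\<delta> > 0" "x = 2 * r * \<delta>" using True assms(1) by (auto simp: r_def)
    have r: "0 < r" "r \<le> 1 / 2" using True assms(1) by (auto simp: r_def field_simps)
    have "(\<Sum>j\<in>{0..<k}. v j) \<le> exp (- ((\<delta> - x) * ln (sqrt (1 - r)) + \<delta> * ln (sqrt (1 + r))))"
    proof (rule markov)
      fix j assume "j \<in> {0..<k}"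
      then have "real j \<le> \<delta> - x" using assms(2) by auto
      then show "(\<delta> - x) * ln (sqrt (1 - r)) \<le> real j * ln (sqrt (1 - r))"
        using r by (intro mult_right_mono_neg) auto
    qed (use r assms(3) in auto)
    also have "\<dots> \<le> exp (- x\<^sup>2 / 8 / (\<delta> + x))"
    proof -
      have "\<delta> * r\<^sup>2 \<le> \<delta> * (ln (1 + r) + (1 - 2 * r) * ln (1 - r))"
        using ln_tail_inequality[of r] r d(1) by (intro mult_left_mono) auto
      moreover have "(\<delta> - x) * ln (sqrt (1 - r)) + \<delta> * ln (sqrt (1 + r)) =
          \<delta> * (ln (1 + r) + (1 - 2 * r) * ln (1 - r)) / 2"
        using r by (simp add: ln_sqrt d(2) algebra_simps)
      \<comment> \<open>The computation yields denominator \<open>\<delta>\<close>; enlarging it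
        gives the form shared with the upper tail.\<close>
      moreover have "x\<^sup>2 / 8 / (\<delta> + x) \<le> x\<^sup>2 / 8 / \<delta>"
        using d(1) assms(1) by (intro divide_left_mono) auto
      moreover have "x\<^sup>2 / 8 / \<delta> = \<delta> * r\<^sup>2 / 2"
        using d(1) by (simp add: d(2) power2_eq_square)
      ultimately show ?thesis by simp
    qed
    finally show ?thesis .
  qed
  finally show ?thesis .
qed

end

section \<open>Tails of a cone and of its polar\<close>

lemma intrinsic_distribution_intrinsic_volume:
  fixes C :: "'a::euclidean_space set"
  assumes C: "closed C" "convex_cone C"
  shows "intrinsic_distribution (\<lambda>k. intrinsic_volume k C) DIM('a) (statistical_dimension C)"
proof
  show "(\<Sum>k=0..DIM('a). intrinsic_volume k C * s ^ k) * (\<Sum>k=0..DIM('a). intrinsic_volume k C * s' ^ k) \<le> 1"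
    if "0 < s" "0 < s'" "s\<^sup>2 + s'\<^sup>2 = 2" for s s' :: real
    using gaussian_weight_mult_le[OF C that] that by (simp add: gaussian_weight_intrinsic_volume[OF C])
qed (simp_all add: statistical_dimension_def sum_intrinsic_volume[OF C] intrinsic_volume_nonneg[OF C])

lemma statistical_dimension_polar_cone:
  fixes C :: "'a::euclidean_space set"
  assumes C: "closed C" "convex_cone C"
  shows "statistical_dimension (polar_cone C) = DIM('a) - statistical_dimension C"
proof -
  have "statistical_dimension (polar_cone C) =
      (\<Sum>k=0..DIM('a). real k * intrinsic_volume (DIM('a) - k) C)"
    by (simp add: statistical_dimension_def intrinsic_volume_polar_cone[OF C])
  also have "\<dots> = (\<Sum>k=0..DIM('a). real (DIM('a) - k) * intrinsic_volume (DIM('a) - (DIM('a) - k)) C)"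
    using sum.atLeastAtMost_rev[of "\<lambda>k. real k * intrinsic_volume (DIM('a) - k) C" 0 "DIM('a)"] by simp
  also have "\<dots> = (\<Sum>k=0..DIM('a). DIM('a) * intrinsic_volume k C - real k * intrinsic_volume k C)"
    by (intro sum.cong) (auto simp: of_nat_diff algebra_simps)
  also have "\<dots> = DIM('a) - statistical_dimension C"
    by (simp add: sum_subtractf sum_distrib_left[symmetric] sum_intrinsic_volume[OF C] statistical_dimension_def)
  finally show ?thesis .
qed

text \<open>Index reversal sends the indices below \<open>k\<close> to those from
  \<open>DIM('a) - k + 1\<close> on, so lower tails of \<open>C\<close> become upper tails of the
  polar.\<close>

lemma tail_functional_polar_cone:
  fixes C :: "'a::euclidean_space set"
  assumes C: "closed C" "convex_cone C" and k: "k \<le> DIM('a)"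
  shows "tail_functional k C = 1 - tail_functional (DIM('a) - k + 1) (polar_cone C)"
proof -
  let ?n = "DIM('a)"
  have "tail_functional (?n - k + 1) (polar_cone C) = (\<Sum>j\<in>{?n - k + 1..?n}. intrinsic_volume (?n - j) C)"
    by (simp add: tail_functional_def intrinsic_volume_polar_cone[OF C])
  also have "\<dots> = (\<Sum>j\<in>{0..<k}. intrinsic_volume j C)"
    using k by (intro sum.reindex_bij_witness[of _ "\<lambda>j. ?n - j" "\<lambda>j. ?n - j"]) auto
  finally have "tail_functional (?n - k + 1) (polar_cone C) = (\<Sum>j\<in>{0..<k}. intrinsic_volume j C)" .
  moreover have "{0..?n} = {0..<k} \<union> {k..?n}" using k by auto
  then have "(\<Sum>j=0..?n. intrinsic_volume j C) = (\<Sum>j\<in>{0..<k} \<union> {k..?n}. intrinsic_volume j C)"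
    by (simp only:)
  moreover have "\<dots> = (\<Sum>j\<in>{0..<k}. intrinsic_volume j C) + (\<Sum>j=k..?n. intrinsic_volume j C)"
    by (intro sum.union_disjoint) auto
  ultimately show ?thesis
    using sum_intrinsic_volume[OF C] by (simp add: tail_functional_def)
qed

theorem theorem6p1:
  fixes C :: "'a::euclidean_space set"
    and lam :: real
    and km kp :: nat
  assumes "closed C" and "convex_cone C"
    and "lam \<ge> 0"
    and "km \<in> {0..DIM('a)}" and "kp \<in> {0..DIM('a)}"
  shows "(real km \<le> statistical_dimension C - lam + 1
            \<longrightarrow> tail_functional km C \<ge> 1 - p_bound C lam)
       \<and> (real kp \<ge> statistical_dimension C + lam
            \<longrightarrow> tail_functional kp C \<le> p_bound C lam)"
proof -
  note C = assms(1,2)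
  have C': "closed (polar_cone C)" "convex_cone (polar_cone C)"
    by (rule closed_polar_cone convex_cone_polar_cone)+
  interpret C: intrinsic_distribution "\<lambda>k. intrinsic_volume k C" "DIM('a)" "statistical_dimension C"
    by (rule intrinsic_distribution_intrinsic_volume[OF C])
  interpret P: intrinsic_distribution "\<lambda>k. intrinsic_volume k (polar_cone C)" "DIM('a)"
      "statistical_dimension (polar_cone C)"
    by (rule intrinsic_distribution_intrinsic_volume[OF C'])
  let ?d = "statistical_dimension C" and ?d' = "statistical_dimension (polar_cone C)"
  have d': "?d' = DIM('a) - ?d" by (rule statistical_dimension_polar_cone[OF C])
  have w: "(transition_width C)\<^sup>2 = min ?d ?d'"
    using C.mean_nonneg P.mean_nonneg by (simp add: transition_width_def)
  have km: "km \<le> DIM('a)" and kp: "kp \<le> DIM('a)" using assms(4,5) by auto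
  show ?thesis
  proof (cases "lam = 0")
    case True
    \<comment> \<open>The tail lemmas assume a positive deviation. At \<open>lam = 0\<close> every
      tail lies between 0 and 1 while \<open>p_bound\<close> equals 4, also when the width vanishes,
      by \<open>0 / 0 = 0\<close>.\<close>
    have "0 \<le> tail_functional k C" for k
      unfolding tail_functional_def by (intro sum_nonneg C.nonneg) auto
    moreover have "tail_functional k C \<le> 1" for k
      unfolding tail_functional_def C.total[symmetric]
      by (intro sum_mono2 C.nonneg) auto
    moreover have "p_bound C lam = 4" using True by (simp add: p_bound_def)
    ultimately show ?thesis by (smt (verit))
  next
    case False
    then have lam: "lam > 0" using assms(3) by simp
    have p: "exp (- lam\<^sup>2 / 8 / (min ?d ?d' + lam)) \<le> p_bound C lam"
      by (simp add: p_bound_def w)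
    show ?thesis
    \<comment> \<open>The cone attaining the minimum decides whose tail bounds are used, since their
      denominators contain the statistical dimension of that cone.\<close>
    proof (cases "?d \<le> ?d'")
      case True
      show ?thesis
        using C.lower_tail[OF lam, of km] C.upper_tail[OF lam, of kp] km p True
        by (auto simp: tail_functional_def min_def)
    next
      case False
      show ?thesis
        \<comment> \<open>Duality exchanges the two claims. By \<open>d'\<close>, the condition on
          \<open>km\<close> becomes that of \<open>P.upper_tail\<close> at
          \<open>DIM('a) - km + 1\<close>, and the condition on \<open>kp\<close> becomes that of
          \<open>P.lower_tail\<close> at \<open>DIM('a) - kp + 1\<close>; the shifts by 1 match
          exactly.\<close>
        using P.lower_tail[OF lam, of "DIM('a) - kp + 1"] P.upper_tail[OF lam, of "DIM('a) - km + 1"]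
          km kp p False tail_functional_polar_cone[OF C km] tail_functional_polar_cone[OF C kp]
        by (auto simp: tail_functional_def[of _ "polar_cone C"] min_def d' of_nat_diff)
    qed
  qed
qed

end
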